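(* Let $T^*$, $t_*$, $\hat B$, $\beta$ be as defined in the context, and assume that $$2\alpha\left(\hat B\,(T^* )^{-\frac{1-\beta}{2}}+\frac1{\sqrt{T^*}}\right)<1.$$ Let $T<t_*$ be arbitrary (it is not required that $T<T^*$). Let $(L_t)$ be the loss function of the McKean--Vlasov system and, for $n\ge1$ and $h=T/n$, let $(\tilde L_{t_i})_{0\le i\le n}$ be the loss function of the discretized process on the uniform mesh $t_i=ih$. Then, for any $\delta>0$, there exists $C>0$ independent of $h$ such that $$\max_{i\le n}\,|\tilde L_{t_i}-L_{t_i}|\le C\,h^{\frac12-\delta}.$$
   Context: Setting: $\alpha,T\in\mathbb{R}_+$ (positive); $W$ is a standard Brownian motion on a filtered probability space $(\Omega,\mathcal F,(\mathcal F_t)_{t\ge0},\mathbb P)$, and $Y_0$ is an $\mathbb{R}_+$-valued random variable independent of $W$. McKean--Vlasov system: $Y_t=Y_0+W_t-\alpha L_t$, $L_t=\mathbb P(\tau\le t)$, $\tau=\inf\{t: Y_t\le 0\}$ ($t\in[0,T]$). Assumption on $Y_0$: $Y_0$ has a density $f_{Y_0}$ supported on $\mathbb R_+$ with $f_{Y_0}(x)\le B x^{\beta}$ for all $x\ge0$, for some $\beta\in(0,1]$ and a constant $B$. Known fact (existence and regularity, taken as background): under this assumption there is a unique differentiable solution $t\mapsto L_t$ of the system up to the explosion time $t_*:=\sup\{t>0:\|L\|_{H^1(0,t)}<\infty\}\in[0,\infty]$, and there is a constant $\hat B$ with $L_t'\le\hat B\,t^{-\frac{1-\beta}{2}}$ for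 a.e. $t<t_*$; this is the $\hat B$ in the claim. Consequently $L_t\le\tilde B\,t^{\frac{1+\beta}{2}}$ for $t<t_*$ for some constant $\tilde B$ (e.g. $\tilde B=2\hat B/(1+\beta)$). $L$ denotes this solution and $Y$ the corresponding process. Definition of $T^*$: $T^*$ is defined by $$\alpha B\left[\sqrt{\tfrac{2T^*}{\pi}}+\alpha\tilde B\,(T^* )^{\frac{1+\beta}{2}}\right]^{\beta}=1,$$ with $B$ and $\tilde B$ the smallest constants such that $f_{Y_0}(x)\le Bx^\beta$ for all $x\ge 0$ and $L_t\le\tilde B t^{\frac{1+\beta}{2}}$ for all $t<t_*$ hold for the given $\beta$. Discretized process on the uniform mesh $0=t_0<t_1<\dots<t_n=T$, $t_i-t_{i-1}=h$: $\tilde Y_{t_0}=Y_0$, $\tilde L_{t_0}=0$, and for $1\le i\le n$, $$\tilde Y_{t_i}=Y_0+W_{t_i}-\alpha\tilde L_{t_i},\qquad \tilde L_{t_i}=\mathbb P(\tilde\tau<t_i),\qquad \tilde\tau=\min\{t_j:0\le j\le n,\ \tilde Y_{t_j}\le0\}$$ (with $\min\emptyset=\infty$). Thus $\tilde L_{t_i}=\mathbb P(\min_{j<i}\tilde Y_{t_j}\le 0)$, so the scheme is explicit. *)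

theory Defs
  imports "HOL-Probability.Probability"
begin

section \<open>Brownian motion on a filtered probability space\<close>

definition filtered_prob_space :: "'a measure \<Rightarrow> (real \<Rightarrow> 'a measure) \<Rightarrow> bool" where
  "filtered_prob_space M F \<longleftrightarrow>
     prob_space M \<and>
     (\<forall>t\<ge>0. subalgebra M (F t)) \<and>
     (\<forall>s t. 0 \<le> s \<longrightarrow> s \<le> t \<longrightarrow> subalgebra (F t) (F s))"

text \<open>All paths are continuous (not merely almost all), so that hitting times of continuous
  processes driven by \<open>W\<close> are measurable without completing \<open>M\<close>.\<close>

definition brownian_motion ::
    "'a measure \<Rightarrow> (real \<Rightarrow> 'a measure) \<Rightarrow> (real \<Rightarrow> 'a \<Rightarrow> real) \<Rightarrow> bool" where
  "brownian_motion M F W \<longleftrightarrow>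
     (\<forall>t\<ge>0. W t \<in> borel_measurable (F t)) \<and>
     (AE \<omega> in M. W 0 \<omega> = 0) \<and>
     (\<forall>\<omega>\<in>space M. continuous_on {0..} (\<lambda>t. W t \<omega>)) \<and>
     (\<forall>s t. 0 \<le> s \<longrightarrow> s < t \<longrightarrow>
        distributed M lborel (\<lambda>\<omega>. W t \<omega> - W s \<omega>)
          (\<lambda>x. ennreal (normal_density 0 (sqrt (t - s)) x)) \<and>
        prob_space.indep_set M (sets (F s))
          (sets (vimage_algebra (space M) (\<lambda>\<omega>. W t \<omega> - W s \<omega>) borel)))"


section \<open>The Sobolev space \<open>H\<^sup>1(a,b)\<close>\<close>

text \<open>\<open>\<phi>\<close> is a continuously differentiable function with derivative \<open>\<phi>'\<close> and compact support
  in the open interval \<open>(a,b)\<close>.\<close>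

definition C1_test_fun :: "real \<Rightarrow> real \<Rightarrow> (real \<Rightarrow> real) \<Rightarrow> (real \<Rightarrow> real) \<Rightarrow> bool" where
  "C1_test_fun a b \<phi> \<phi>' \<longleftrightarrow>
     (\<forall>x. (\<phi> has_real_derivative \<phi>' x) (at x)) \<and> continuous_on UNIV \<phi>' \<and>
     (\<exists>c d. a < c \<and> d < b \<and> (\<forall>x. x \<notin> {c..d} \<longrightarrow> \<phi> x = 0))"

definition L2_on :: "real \<Rightarrow> real \<Rightarrow> (real \<Rightarrow> real) \<Rightarrow> bool" where
  "L2_on a b u \<longleftrightarrow> set_borel_measurable lborel {a<..<b} u \<and>
     set_integrable lborel {a<..<b} (\<lambda>x. (u x)\<^sup>2)"

text \<open>\<open>u \<in> H\<^sup>1(a,b)\<close> with weak derivative \<open>g\<close>.\<close>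

definition H1_weak_deriv :: "real \<Rightarrow> real \<Rightarrow> (real \<Rightarrow> real) \<Rightarrow> (real \<Rightarrow> real) \<Rightarrow> bool" where
  "H1_weak_deriv a b u g \<longleftrightarrow> L2_on a b u \<and> L2_on a b g \<and>
     (\<forall>\<phi> \<phi>'. C1_test_fun a b \<phi> \<phi>' \<longrightarrow>
        (LBINT x:{a<..<b}. u x * \<phi>' x) = - (LBINT x:{a<..<b}. g x * \<phi> x))"

text \<open>The weak derivative is unique up to null sets, so the infimum ranges over at most one value;
  it is \<open>\<infinity>\<close> if \<open>u\<close> is not in \<open>H\<^sup>1(a,b)\<close>.\<close>

definition H1_norm :: "real \<Rightarrow> real \<Rightarrow> (real \<Rightarrow> real) \<Rightarrow> ereal" where
  "H1_norm a b u =
     (INF g\<in>{g. H1_weak_deriv a b u g}.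
        ereal (sqrt ((LBINT x:{a<..<b}. (u x)\<^sup>2) + (LBINT x:{a<..<b}. (g x)\<^sup>2))))"


section \<open>The McKean--Vlasov system\<close>

definition mv_process ::
    "real \<Rightarrow> ('a \<Rightarrow> real) \<Rightarrow> (real \<Rightarrow> 'a \<Rightarrow> real) \<Rightarrow> (real \<Rightarrow> real) \<Rightarrow> real \<Rightarrow> 'a \<Rightarrow> real" where
  "mv_process \<alpha> Y0 W L t \<omega> = Y0 \<omega> + W t \<omega> - \<alpha> * L t"

definition hitting_time :: "(real \<Rightarrow> 'a \<Rightarrow> real) \<Rightarrow> 'a \<Rightarrow> ereal" where
  "hitting_time Y \<omega> = Inf {ereal t | t. 0 \<le> t \<and> Y t \<omega> \<le> 0}"

text \<open>\<open>L\<close> solves the system on \<open>[0,S)\<close>. For \<open>t < S\<close>, the event that the hitting time is at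
  most \<open>t\<close> does not depend on the values of \<open>L\<close> on \<open>[S,\<infinity>)\<close>, which are arbitrary.\<close>

definition mv_solution ::
    "'a measure \<Rightarrow> real \<Rightarrow> ('a \<Rightarrow> real) \<Rightarrow> (real \<Rightarrow> 'a \<Rightarrow> real) \<Rightarrow> ereal \<Rightarrow> (real \<Rightarrow> real) \<Rightarrow> bool" where
  "mv_solution M \<alpha> Y0 W S L \<longleftrightarrow>
     (\<forall>t\<ge>0. ereal t < S \<longrightarrow>
        L t = measure M {\<omega> \<in> space M. hitting_time (mv_process \<alpha> Y0 W L) \<omega> \<le> ereal t})"

text \<open>Differentiability is meant in the weak sense: \<open>L\<close> is continuous and in \<open>H\<^sup>1(0,t)\<close> for all
  \<open>t < S\<close>. The condition \<open>L 0 = 0\<close> is not redundant: if \<open>Y0 \<le> \<alpha>\<close> almost surely, then the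
  constant function \<open>1\<close> satisfies the fixed-point equation as well.\<close>

definition differentiable_mv_solution ::
    "'a measure \<Rightarrow> real \<Rightarrow> ('a \<Rightarrow> real) \<Rightarrow> (real \<Rightarrow> 'a \<Rightarrow> real) \<Rightarrow> ereal \<Rightarrow> (real \<Rightarrow> real) \<Rightarrow> bool" where
  "differentiable_mv_solution M \<alpha> Y0 W S L \<longleftrightarrow>
     mv_solution M \<alpha> Y0 W S L \<and> L 0 = 0 \<and>
     continuous_on {t. 0 \<le> t \<and> ereal t < S} L \<and>
     (\<forall>t>0. ereal t < S \<longrightarrow> H1_norm 0 t L < \<infinity>)"

text \<open>The element \<open>0\<close> makes the supremum \<open>0\<close> rather than \<open>-\<infinity>\<close> if there is no such \<open>t\<close>.\<close>

definition explosion_time :: "(real \<Rightarrow> real) \<Rightarrow> ereal" where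
  "explosion_time L = Sup (insert 0 {ereal t | t. 0 < t \<and> H1_norm 0 t L < \<infinity>})"

text \<open>The differentiable solution up to the explosion time. The maximality clause excludes functions
  that follow the solution only up to some earlier time and are continued arbitrarily from
  there, which would have a smaller value of \<open>explosion_time\<close>.\<close>

definition mv_solution_up_to_explosion ::
    "'a measure \<Rightarrow> real \<Rightarrow> ('a \<Rightarrow> real) \<Rightarrow> (real \<Rightarrow> 'a \<Rightarrow> real) \<Rightarrow> (real \<Rightarrow> real) \<Rightarrow> bool" where
  "mv_solution_up_to_explosion M \<alpha> Y0 W L \<longleftrightarrow>
     differentiable_mv_solution M \<alpha> Y0 W (explosion_time L) L \<and>
     (\<forall>S K. differentiable_mv_solution M \<alpha> Y0 W S K \<longrightarrow> S \<le> explosion_time L)"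


section \<open>The discretized process\<close>

definition discrete_process ::
    "real \<Rightarrow> ('a \<Rightarrow> real) \<Rightarrow> (real \<Rightarrow> 'a \<Rightarrow> real) \<Rightarrow> real \<Rightarrow> (nat \<Rightarrow> real) \<Rightarrow> nat \<Rightarrow> 'a \<Rightarrow> real" where
  "discrete_process \<alpha> Y0 W h Lt i \<omega> =
     (if i = 0 then Y0 \<omega> else Y0 \<omega> + W (real i * h) \<omega> - \<alpha> * Lt i)"

text \<open>The infimum is a minimum over a finite set, and \<open>\<infinity>\<close> if that set is empty.\<close>

definition discrete_hitting_time :: "real \<Rightarrow> nat \<Rightarrow> (nat \<Rightarrow> 'a \<Rightarrow> real) \<Rightarrow> 'a \<Rightarrow> ereal" where
  "discrete_hitting_time h n Yt \<omega> = Inf {ereal (real j * h) | j. j \<le> n \<and> Yt j \<omega> \<le> 0}"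

text \<open>\<open>Lt\<close> is the loss function of the scheme with \<open>n\<close> steps of size \<open>h\<close>; \<open>Lt i\<close> is its value at
  time \<open>i h\<close>. The lemmas below show that these equations have a solution, unique on \<open>{..n}\<close>.\<close>

definition discrete_loss ::
    "'a measure \<Rightarrow> real \<Rightarrow> ('a \<Rightarrow> real) \<Rightarrow> (real \<Rightarrow> 'a \<Rightarrow> real) \<Rightarrow> real \<Rightarrow> nat \<Rightarrow> (nat \<Rightarrow> real) \<Rightarrow> bool" where
  "discrete_loss M \<alpha> Y0 W h n Lt \<longleftrightarrow>
     Lt 0 = 0 \<and>
     (\<forall>i\<in>{1..n}. Lt i = measure M {\<omega> \<in> space M.
        discrete_hitting_time h n (discrete_process \<alpha> Y0 W h Lt) \<omega> < ereal (real i * h)})"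

lemma discrete_hitting_time_less_iff:
  assumes "h > 0" "i \<le> n"
  shows "discrete_hitting_time h n Yt \<omega> < ereal (real i * h) \<longleftrightarrow> (\<exists>j<i. Yt j \<omega> \<le> 0)"
proof -
  have "discrete_hitting_time h n Yt \<omega> < ereal (real i * h) \<longleftrightarrow>
      (\<exists>j\<le>n. Yt j \<omega> \<le> 0 \<and> real j * h < real i * h)"
    unfolding discrete_hitting_time_def Inf_less_iff by auto
  also have "\<dots> \<longleftrightarrow> (\<exists>j\<le>n. Yt j \<omega> \<le> 0 \<and> j < i)"
    using assms(1) by simp
  also have "\<dots> \<longleftrightarrow> (\<exists>j<i. Yt j \<omega> \<le> 0)"
    using assms(2) by (meson less_le_trans less_imp_le)
  finally show ?thesis .
qed

lemma discrete_loss_explicit: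
  assumes "h > 0"
  shows "discrete_loss M \<alpha> Y0 W h n Lt \<longleftrightarrow>
     Lt 0 = 0 \<and> (\<forall>i\<in>{1..n}. Lt i =
        measure M {\<omega> \<in> space M. \<exists>j<i. discrete_process \<alpha> Y0 W h Lt j \<omega> \<le> 0})"
  unfolding discrete_loss_def
  by (intro conj_cong refl ball_cong arg_cong2[where f = "(=)"] arg_cong2[where f = measure]
      Collect_cong discrete_hitting_time_less_iff assms) auto

lemma discrete_loss_exists:
  assumes h: "h > 0"
  shows "\<exists>Lt. discrete_loss M \<alpha> Y0 W h n Lt"
proof (induction n)
  case 0
  show ?case by (rule exI[of _ "\<lambda>_. 0"]) (simp add: discrete_loss_def)
next
  case (Suc n)
  then obtain Lt where Lt: "discrete_loss M \<alpha> Y0 W h n Lt" ..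
  define K where "K = Lt(Suc n := measure M {\<omega> \<in> space M.
    \<exists>j<Suc n. discrete_process \<alpha> Y0 W h Lt j \<omega> \<le> 0})"
  have eq: "(\<exists>j<i. discrete_process \<alpha> Y0 W h K j \<omega> \<le> 0) \<longleftrightarrow>
      (\<exists>j<i. discrete_process \<alpha> Y0 W h Lt j \<omega> \<le> 0)" if "i \<le> Suc n" for i \<omega>
  proof -
    have "K j = Lt j" if "j < i" for j
      using that \<open>i \<le> Suc n\<close> by (simp add: K_def)
    then show ?thesis unfolding discrete_process_def by metis
  qed
  have "K i = measure M {\<omega> \<in> space M. \<exists>j<i. discrete_process \<alpha> Y0 W h K j \<omega> \<le> 0}"
    if "i \<in> {1..Suc n}" for i
  proof (cases "i = Suc n")
    case True
    show ?thesis unfolding True eq[OF order_refl] by (simp only: K_def fun_upd_same)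
  next
    case False
    with that have i: "i \<in> {1..n}" "i \<le> Suc n" by auto
    have "K i = Lt i" using i by (simp add: K_def)
    also have "\<dots> = measure M {\<omega> \<in> space M. \<exists>j<i. discrete_process \<alpha> Y0 W h Lt j \<omega> \<le> 0}"
      using Lt i(1) unfolding discrete_loss_explicit[OF h] by blast
    finally show ?thesis by (simp only: eq[OF i(2)])
  qed
  moreover have "Lt 0 = 0"
    using Lt unfolding discrete_loss_def by (rule conjunct1)
  then have "K 0 = 0"
    by (simp add: K_def)
  ultimately have "discrete_loss M \<alpha> Y0 W h (Suc n) K"
    unfolding discrete_loss_explicit[OF h] by blast
  then show ?case by blast
qed

lemma discrete_loss_unique:
  assumes h: "h > 0" and 1: "discrete_loss M \<alpha> Y0 W h n Lt" and 2: "discrete_loss M \<alpha> Y0 W h n Lt'"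
  shows "i \<le> n \<Longrightarrow> Lt i = Lt' i"
proof (induction i rule: less_induct)
  case (less i)
  have eq: "(\<exists>j<i. discrete_process \<alpha> Y0 W h Lt j \<omega> \<le> 0) \<longleftrightarrow>
      (\<exists>j<i. discrete_process \<alpha> Y0 W h Lt' j \<omega> \<le> 0)" for \<omega>
  proof -
    have "Lt j = Lt' j" if "j < i" for j
      using less.IH[of j] less.prems that by linarith
    then show ?thesis unfolding discrete_process_def by metis
  qed
  show ?case
  proof (cases "i = 0")
    case True
    then show ?thesis using 1 2 unfolding discrete_loss_def by metis
  next
    case False
    then have i: "i \<in> {1..n}" using less.prems by auto
    have "Lt i = measure M {\<omega> \<in> space M. \<exists>j<i. discrete_process \<alpha> Y0 W h Lt j \<omega> \<le> 0}"
      using 1 i unfolding discrete_loss_explicit[OF h] by blast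
    also have "\<dots> = measure M {\<omega> \<in> space M. \<exists>j<i. discrete_process \<alpha> Y0 W h Lt' j \<omega> \<le> 0}"
      by (simp only: eq)
    also have "\<dots> = Lt' i"
      using 2 i unfolding discrete_loss_explicit[OF h] by (elim conjE) (rule sym, erule bspec)
    finally show ?thesis .
  qed
qed


section \<open>Smallest constants\<close>

definition smallest_const :: "(real \<Rightarrow> bool) \<Rightarrow> real \<Rightarrow> bool" where
  "smallest_const P c \<longleftrightarrow> P c \<and> (\<forall>c'. P c' \<longrightarrow> c \<le> c')"

end

theory Submission
  imports Defs
begin

text \<open>Write \<open>t\<^sub>k = k h\<close> and \<open>e\<^sub>k = L (t\<^sub>k) - Lt k\<close>. The scheme is explicit: its loss at \<open>t\<^sub>i\<close> counts the
  particles found below zero before \<open>t\<^sub>i\<close>, at mesh points only. By induction the discrete barrier never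
  gets ahead of the true one, so \<open>e\<^sub>k \<ge> 0\<close> (\<open>scheme_le_loss\<close>) and only particles absorbed by the true
  system and not by the scheme have to be counted.

  Consider such a particle, absorbed by the true system in the mesh interval that ends at \<open>t\<^sub>k\<close>. There
  the barrier of the scheme is at distance \<open>\<alpha> e\<^sub>k\<close> from the true one, and afterwards it only moves
  against the particle. To survive in the scheme until \<open>t\<^sub>i\<close>, the path of \<open>W\<close> must avoid descending by
  \<open>\<alpha> e\<^sub>k\<close> plus its oscillation \<open>\<eta>\<close> within a mesh interval, and by the reflection principle the
  probability of this is at most a constant times \<open>(\<alpha> e\<^sub>k + \<eta>) / sqrt (t\<^sub>i - t\<^sub>k)\<close>
  (\<open>survival_after_hit\<close>). The probability of absorption in the interval is an increment of \<open>L\<close>, which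
  the growth bounds on \<open>L\<close> and on its derivative estimate by a multiple of
  \<open>h t\<^sub>k powr (- (1 - \<beta>) / 2)\<close> (\<open>loss_increment_on_mesh\<close>). Altogether
  \<open>e\<^sub>i \<le> c \<eta> + c (\<Sum>k<i. h t\<^sub>k powr (- (1 - \<beta>) / 2) (t\<^sub>i - t\<^sub>k) powr (- 1/2) e\<^sub>k)\<close>.
  The exponents add up to \<open>1 - \<beta> / 2 < 1\<close>, so this weakly singular Volterra inequality gives \<open>e\<^sub>i \<le> C \<eta>\<close>
  on the whole of \<open>[0,T]\<close> by a Gronwall argument (\<open>discrete_singular_gronwall\<close>), with a constant that
  does not depend on \<open>h\<close>. The oscillation of a Brownian path over an interval of length \<open>h\<close> exceeds
  \<open>\<eta> = h powr (1/2 - \<delta>)\<close> with a probability smaller than any power of \<open>h\<close> (\<open>prob_oscillation_le\<close>), and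
  that is the only source of the loss \<open>\<delta>\<close> in the rate.

  The events above involve the initial value, so the argument runs in a filtration enlarged by it, in
  which \<open>W\<close> is still a Brownian motion (\<open>brownian_motion_initial_enlargement\<close>).\<close>

section \<open>Walks with symmetric increments\<close>

text \<open>Levy's inequality and the reflection argument stop the walk at a first entry and then exchange the
  remaining increment with its negative. Conditional symmetry of the increment from step \<open>j\<close> to the
  last step \<open>m\<close>, on every event known at step \<open>j\<close>, is what makes this exchange possible.\<close>

locale symmetric_walk = prob_space M
  for M :: "'a measure" +
  fixes G :: "nat \<Rightarrow> 'a measure" and S :: "nat \<Rightarrow> 'a \<Rightarrow> real" and m :: nat
  assumes subalgebra_G: "j \<le> m \<Longrightarrow> subalgebra M (G j)"
    and filtration_G: "i \<le> j \<Longrightarrow> j \<le> m \<Longrightarrow> sets (G i) \<subseteq> sets (G j)"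
    and adapted_S: "i \<le> j \<Longrightarrow> j \<le> m \<Longrightarrow> S i \<in> borel_measurable (G j)"
    and symmetric_after: "j \<le> m \<Longrightarrow> A \<in> sets (G j) \<Longrightarrow>
      prob (A \<inter> {\<omega> \<in> space M. x < S m \<omega> - S j \<omega>}) =
      prob (A \<inter> {\<omega> \<in> space M. S m \<omega> - S j \<omega> < - x})"
begin

definition first_entry :: "real set \<Rightarrow> nat \<Rightarrow> 'a set" where
  "first_entry H j = {\<omega> \<in> space M. S j \<omega> \<in> H \<and> (\<forall>i<j. S i \<omega> \<notin> H)}"

lemma space_G: "j \<le> m \<Longrightarrow> space (G j) = space M"
  using subalgebra_G by (auto simp: subalgebra_def)

lemma sets_G_subset: "j \<le> m \<Longrightarrow> sets (G j) \<subseteq> sets M"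
  using subalgebra_G by (auto simp: subalgebra_def)

lemma measurable_S: "j \<le> m \<Longrightarrow> S j \<in> borel_measurable M"
  using measurable_from_subalg[OF subalgebra_G adapted_S[of j j]] by auto

lemma first_entry_sets:
  assumes "j \<le> m" "H \<in> sets borel"
  shows "first_entry H j \<in> sets (G j)"
proof -
  have S: "S i \<in> borel_measurable (G j)" if "i \<le> j" for i
    using that assms adapted_S by auto
  have SH: "S i -` H \<inter> space (G j) \<in> sets (G j)" if "i \<le> j" for i
    by (rule measurable_sets[OF S[OF that] assms(2)])
  have "first_entry H j = (S j -` H \<inter> space (G j)) \<inter>
      (\<Inter>i<j. space (G j) - (S i -` H \<inter> space (G j))) \<inter> space (G j)"
    by (auto simp: first_entry_def space_G[OF assms(1)])
  also have "\<dots> \<in> sets (G j)"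
  proof (cases "j = 0")
    case False
    then show ?thesis
      by (intro sets.Int sets.finite_INT sets.Diff SH sets.top) auto
  qed (use SH[of j] in \<open>simp add: sets.Int\<close>)
  finally show ?thesis .
qed

lemma disjoint_first_entry: "disjoint_family (first_entry H)"
  unfolding disjoint_family_on_def first_entry_def
  by (auto, metis linorder_neqE_nat)

text \<open>This is how a comparison made separately on each possible first entry time becomes a comparison of
  two probabilities on the event that the walk enters at all.\<close>

lemma prob_UN_compare:
  fixes I :: "nat set"
  assumes "finite I" "disjoint_family_on E I"
    and "\<And>j. j \<in> I \<Longrightarrow> E j \<in> sets M" and "C \<in> sets M" "D \<in> sets M"
    and "\<And>j. j \<in> I \<Longrightarrow> prob (E j \<inter> C) \<le> prob (E j \<inter> D)"
  shows "prob ((\<Union>j\<in>I. E j) \<inter> C) \<le> prob ((\<Union>j\<in>I. E j) \<inter> D)"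
proof -
  have *: "prob ((\<Union>j\<in>I. E j) \<inter> X) = (\<Sum>j\<in>I. prob (E j \<inter> X))" if "X \<in> sets M" for X
  proof -
    have "prob (\<Union>j\<in>I. E j \<inter> X) = (\<Sum>j\<in>I. prob (E j \<inter> X))"
      using assms that by (intro finite_measure_finite_Union)
        (auto simp: disjoint_family_on_def)
    then show ?thesis by (simp add: Int_UN_distrib2)
  qed
  show ?thesis
    unfolding *[OF assms(4)] *[OF assms(5)] by (intro sum_mono assms)
qed

lemma ex_first_entry:
  assumes "\<omega> \<in> space M" "j \<le> m" "S j \<omega> \<in> H"
  shows "\<omega> \<in> (\<Union>j\<in>{..m}. first_entry H j)"
proof -
  define k where "k = (LEAST k. S k \<omega> \<in> H)"
  have "S k \<omega> \<in> H" "\<forall>i<k. S i \<omega> \<notin> H" "k \<le> j"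
    unfolding k_def using assms(3) by (auto intro: LeastI Least_le dest: not_less_Least)
  then show ?thesis
    using assms by (auto simp: first_entry_def intro!: bexI[of _ k])
qed

text \<open>After its first passage above \<open>x\<close> the walk is as likely to end above its current position as below
  it, so at least half of the paths that pass \<open>x\<close> end above \<open>x\<close>.\<close>

lemma levy_maximal_inequality:
  "prob {\<omega> \<in> space M. \<exists>j\<le>m. x < S j \<omega>} \<le> 2 * prob {\<omega> \<in> space M. x < S m \<omega>}"
proof -
  note [measurable] = measurable_S
  let ?E = "first_entry {x<..}"
  let ?C = "{\<omega> \<in> space M. S m \<omega> \<le> x}" and ?D = "{\<omega> \<in> space M. x < S m \<omega>}"
  have E: "?E j \<in> sets M" if "j \<le> m" for j
    using first_entry_sets[OF that] sets_G_subset[OF that] by auto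
  have "prob ((\<Union>j\<in>{..m}. ?E j) \<inter> ?C) \<le> prob ((\<Union>j\<in>{..m}. ?E j) \<inter> ?D)"
  proof (intro prob_UN_compare)
    fix j assume "j \<in> {..m}"
    then have j: "j \<le> m" by simp
    note [measurable] = E[OF j] measurable_S[OF j]
    have "prob (?E j \<inter> ?C) \<le> prob (?E j \<inter> {\<omega> \<in> space M. S m \<omega> - S j \<omega> < - 0})"
      by (intro finite_measure_mono, (auto simp: first_entry_def)[1], measurable)
    also have "\<dots> = prob (?E j \<inter> {\<omega> \<in> space M. 0 < S m \<omega> - S j \<omega>})"
      by (intro symmetric_after[symmetric] j first_entry_sets) auto
    also have "\<dots> \<le> prob (?E j \<inter> ?D)"
      by (intro finite_measure_mono, (auto simp: first_entry_def)[1], measurable)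
    finally show "prob (?E j \<inter> ?C) \<le> prob (?E j \<inter> ?D)" .
  qed (auto intro: E disjoint_family_on_mono[OF _ disjoint_first_entry])
  also have "\<dots> \<le> prob ?D"
    by (intro finite_measure_mono) auto
  finally have C: "prob ((\<Union>j\<in>{..m}. ?E j) \<inter> ?C) \<le> prob ?D" .
  have "prob {\<omega> \<in> space M. \<exists>j\<le>m. x < S j \<omega>} \<le> prob (((\<Union>j\<in>{..m}. ?E j) \<inter> ?C) \<union> ?D)"
  proof (intro finite_measure_mono subsetI)
    fix \<omega> assume *: "\<omega> \<in> {\<omega> \<in> space M. \<exists>j\<le>m. x < S j \<omega>}"
    then have "\<omega> \<in> (\<Union>j\<in>{..m}. ?E j)"
      using ex_first_entry[of \<omega> _ "{x<..}"] by auto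
    with * show "\<omega> \<in> ((\<Union>j\<in>{..m}. ?E j) \<inter> ?C) \<union> ?D" by auto
  qed (use E in auto)
  also have "\<dots> \<le> prob ((\<Union>j\<in>{..m}. ?E j) \<inter> ?C) + prob ?D"
    by (intro measure_Un_le) (use E in auto)
  finally show ?thesis using C by simp
qed

text \<open>Reflect the path at its first entry into \<open>[a,\<infinity>)\<close>. A walk in discrete time does not enter at \<open>a\<close> but
  at a point of \<open>[a, a + \<eta>]\<close>, outside the exceptional event \<open>Bd\<close>. A path that ends above \<open>a + 2\<eta>\<close>
  has then climbed by more than \<open>\<eta>\<close> since its entry, and its reflection ends below \<open>a\<close>. So the paths
  ending above \<open>a + 2\<eta>\<close> are matched with paths that end below \<open>a\<close> but have been at \<open>a\<close>, which leaves
  room for only the difference of the two probabilities among the paths that stay below \<open>a\<close>.\<close>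

lemma reflection_with_overshoot:
  assumes A: "A \<in> sets (G 0)" and \<eta>: "0 \<le> \<eta>"
    and Bd: "Bd \<in> sets M"
    and overshoot: "\<And>\<omega> j. \<omega> \<in> space M \<Longrightarrow> \<omega> \<notin> Bd \<Longrightarrow> j \<le> m \<Longrightarrow>
      (\<And>i. i < j \<Longrightarrow> S i \<omega> < a) \<Longrightarrow> S j \<omega> \<le> a + \<eta>"
  shows "prob (A \<inter> {\<omega> \<in> space M. \<forall>j\<le>m. S j \<omega> < a}) \<le>
    prob (A \<inter> {\<omega> \<in> space M. S m \<omega> < a}) - prob (A \<inter> {\<omega> \<in> space M. a + 2 * \<eta> < S m \<omega>})
    + prob (A \<inter> Bd)"
proof -
  note [measurable] = measurable_S Bd
  define E where "E j = first_entry {a..} j \<inter> {\<omega> \<in> space M. S j \<omega> \<le> a + \<eta>} \<inter> A" for j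
  let ?C = "{\<omega> \<in> space M. a + 2 * \<eta> < S m \<omega>}" and ?D = "{\<omega> \<in> space M. S m \<omega> < a}"
  let ?N = "A \<inter> {\<omega> \<in> space M. \<forall>j\<le>m. S j \<omega> < a}"
  have EG: "E j \<in> sets (G j)" if j: "j \<le> m" for j
  proof -
    have [measurable]: "S j \<in> borel_measurable (G j)"
      using j by (intro adapted_S) auto
    have "{\<omega> \<in> space (G j). S j \<omega> \<le> a + \<eta>} \<in> sets (G j)" by measurable
    moreover have "A \<in> sets (G j)" using filtration_G[of 0 j] A j by auto
    ultimately show ?thesis
      unfolding E_def using first_entry_sets[OF j] space_G[OF j] by auto
  qed
  have EM: "E j \<in> sets M" if "j \<le> m" for j
    using EG[OF that] sets_G_subset[OF that] by auto
  have AM[measurable]: "A \<in> sets M" using A sets_G_subset[of 0] by auto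
  \<comment> \<open>reflection, separately for each time of first entry\<close>
  have "prob ((\<Union>j\<in>{..m}. E j) \<inter> ?C) \<le> prob ((\<Union>j\<in>{..m}. E j) \<inter> ?D)"
  proof (intro prob_UN_compare)
    show "disjoint_family_on E {..m}"
      using disjoint_first_entry[of "{a..}"] by (auto simp: disjoint_family_on_def E_def)
    fix j assume "j \<in> {..m}"
    then have j: "j \<le> m" by simp
    note [measurable] = EM[OF j] measurable_S[OF j]
    have "prob (E j \<inter> ?C) \<le> prob (E j \<inter> {\<omega> \<in> space M. \<eta> < S m \<omega> - S j \<omega>})"
      by (intro finite_measure_mono, (auto simp: E_def)[1], measurable)
    also have "\<dots> = prob (E j \<inter> {\<omega> \<in> space M. S m \<omega> - S j \<omega> < - \<eta>})"
      by (intro symmetric_after j EG)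
    also have "\<dots> \<le> prob (E j \<inter> ?D)"
      by (intro finite_measure_mono, (auto simp: E_def)[1], measurable)
    finally show "prob (E j \<inter> ?C) \<le> prob (E j \<inter> ?D)" .
  qed (auto intro: EM)
  moreover have "prob (A \<inter> ?C) \<le> prob ((\<Union>j\<in>{..m}. E j) \<inter> ?C) + prob (A \<inter> Bd)"
  proof -
    have "prob (A \<inter> ?C) \<le> prob (((\<Union>j\<in>{..m}. E j) \<inter> ?C) \<union> (A \<inter> Bd))"
    proof (intro finite_measure_mono subsetI)
      fix \<omega> assume *: "\<omega> \<in> A \<inter> ?C"
      then have "\<omega> \<in> (\<Union>j\<in>{..m}. first_entry {a..} j)"
        using ex_first_entry[of \<omega> m "{a..}"] \<eta> by auto
      then obtain j where j: "j \<le> m" "\<omega> \<in> first_entry {a..} j" by auto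
      have "S j \<omega> \<le> a + \<eta>" if "\<omega> \<notin> Bd"
        using j * that by (intro overshoot) (auto simp: first_entry_def not_le)
      with j * show "\<omega> \<in> ((\<Union>j\<in>{..m}. E j) \<inter> ?C) \<union> (A \<inter> Bd)"
        by (auto simp: E_def)
    qed (use EM in auto)
    also have "\<dots> \<le> prob ((\<Union>j\<in>{..m}. E j) \<inter> ?C) + prob (A \<inter> Bd)"
      by (intro measure_Un_le) (use EM in auto)
    finally show ?thesis .
  qed
  moreover have "prob ?N + prob ((\<Union>j\<in>{..m}. E j) \<inter> ?D) \<le> prob (A \<inter> ?D)"
  proof -
    have [measurable]: "{\<omega> \<in> space M. \<forall>j\<le>m. S j \<omega> < a} \<in> sets M"
    proof -
      have "{\<omega> \<in> space M. \<forall>j\<in>{..m}. S j \<omega> < a} \<in> sets M"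
        by (intro sets.sets_Collect_finite_All) auto
      then show ?thesis by (simp add: Ball_def)
    qed
    have "prob (?N \<union> ((\<Union>j\<in>{..m}. E j) \<inter> ?D)) = prob ?N + prob ((\<Union>j\<in>{..m}. E j) \<inter> ?D)"
    proof (intro finite_measure_Union)
      show "?N \<inter> ((\<Union>j\<in>{..m}. E j) \<inter> ?D) = {}"
        unfolding E_def first_entry_def by fastforce
    qed (use EM in auto)
    moreover have "prob (?N \<union> ((\<Union>j\<in>{..m}. E j) \<inter> ?D)) \<le> prob (A \<inter> ?D)"
      by (intro finite_measure_mono) (auto simp: E_def)
    ultimately show ?thesis by simp
  qed
  ultimately show ?thesis by linarith
qed

end

section \<open>Oscillations of Brownian motion\<close>

lemma (in prob_space) prob_normal_interval:
  assumes X: "distributed M lborel X (\<lambda>x. ennreal (normal_density 0 \<sigma> x))"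
    and \<sigma>: "0 < \<sigma>" and ab: "a \<le> b"
  shows "prob {\<omega> \<in> space M. a \<le> X \<omega> \<and> X \<omega> < b} \<le> (b - a) / (\<sigma> * sqrt (2 * pi))"
proof -
  let ?c = "1 / (\<sigma> * sqrt (2 * pi))"
  have le: "normal_density 0 \<sigma> x \<le> ?c" for x
  proof -
    have "sqrt (2 * pi * \<sigma>\<^sup>2) = \<sigma> * sqrt (2 * pi)"
      using \<sigma> by (simp add: real_sqrt_mult)
    then show ?thesis
      using \<sigma> by (simp add: normal_density_def divide_right_mono)
  qed
  have "emeasure M {\<omega> \<in> space M. a \<le> X \<omega> \<and> X \<omega> < b} = emeasure M (X -` {a..<b} \<inter> space M)"
    by (intro arg_cong[where f = "emeasure M"]) auto
  also have "\<dots> = (\<integral>\<^sup>+x. ennreal (normal_density 0 \<sigma> x) * indicator {a..<b} x \<partial>lborel)"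
    by (rule distributed_emeasure[OF X]) simp
  also have "\<dots> \<le> (\<integral>\<^sup>+x. ennreal ?c * indicator {a..<b} x \<partial>lborel)"
    by (intro nn_integral_mono mult_right_mono ennreal_leI le) auto
  also have "\<dots> = ennreal ((b - a) / (\<sigma> * sqrt (2 * pi)))"
    using ab \<sigma> by (simp add: nn_integral_cmult_indicator ennreal_mult[symmetric])
  finally show ?thesis
    using ab \<sigma> by (simp add: emeasure_eq_measure)
qed

lemma (in prob_space) prob_normal_symmetric:
  assumes X: "distributed M lborel X (\<lambda>x. ennreal (normal_density 0 \<sigma> x))"
  shows "prob {\<omega> \<in> space M. x < X \<omega>} = prob {\<omega> \<in> space M. X \<omega> < - x}"
proof -
  have e: "emeasure M {\<omega> \<in> space M. X \<omega> \<in> A} =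
      (\<integral>\<^sup>+x. ennreal (normal_density 0 \<sigma> x) * indicator A x \<partial>lborel)" if "A \<in> sets borel" for A
  proof -
    have "emeasure M {\<omega> \<in> space M. X \<omega> \<in> A} = emeasure M (X -` A \<inter> space M)"
      by (intro arg_cong[where f = "emeasure M"]) auto
    then show ?thesis using distributed_emeasure[OF X, of A] that by simp
  qed
  have "emeasure M {\<omega> \<in> space M. X \<omega> \<in> {x<..}} =
      (\<integral>\<^sup>+x'. ennreal (normal_density 0 \<sigma> x') * indicator {x<..} x' \<partial>lborel)"
    by (rule e) simp
  also have "\<dots> = (\<integral>\<^sup>+x'. ennreal (normal_density 0 \<sigma> x') * indicator {..< - x} x' \<partial>lborel)"
    by (subst nn_integral_real_affine[where c = "-1" and t = 0])
      (auto simp: normal_density_def indicator_def intro!: nn_integral_cong)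
  also have "\<dots> = emeasure M {\<omega> \<in> space M. X \<omega> \<in> {..< - x}}"
    by (rule e[symmetric]) simp
  finally have "emeasure M {\<omega> \<in> space M. X \<omega> \<in> {x<..}} = emeasure M {\<omega> \<in> space M. X \<omega> \<in> {..< - x}}" .
  then show ?thesis by (simp add: measure_def)
qed

text \<open>Markov's inequality for the moment of order \<open>2k\<close>. In the application \<open>\<sigma> / y\<close> is a positive power of
  the step size, so that a large \<open>k\<close> yields any prescribed order.\<close>

lemma (in prob_space) prob_normal_tail:
  assumes X: "distributed M lborel X (\<lambda>x. ennreal (normal_density 0 \<sigma> x))"
    and \<sigma>: "0 < \<sigma>" and y: "0 < y"
  shows "prob {\<omega> \<in> space M. y < \<bar>X \<omega>\<bar>} \<le> fact (2 * k) / (2 ^ k * fact k) * (\<sigma> / y) ^ (2 * k)"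
proof -
  have [measurable]: "X \<in> borel_measurable M"
    using distributed_measurable[OF X] by simp
  have hb: "has_bochner_integral lborel (\<lambda>x. normal_density 0 \<sigma> x * x ^ (2 * k))
      (fact (2 * k) / ((2 / \<sigma>\<^sup>2)^k * fact k))"
    using normal_moment_even[OF \<sigma>, of 0 k] by simp
  have int: "integrable M (\<lambda>\<omega>. X \<omega> ^ (2 * k))"
    using distributed_integrable[OF X, of "\<lambda>x. x ^ (2 * k)"] hb \<sigma>
    by (auto simp: has_bochner_integral_iff)
  have ex: "expectation (\<lambda>\<omega>. X \<omega> ^ (2 * k)) = fact (2 * k) / ((2 / \<sigma>\<^sup>2)^k * fact k)"
    using distributed_integral[OF X, of "\<lambda>x. x ^ (2 * k)"] hb \<sigma>
    by (auto simp: has_bochner_integral_iff)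
  have "prob {\<omega> \<in> space M. y < \<bar>X \<omega>\<bar>} \<le> prob {\<omega> \<in> space M. y ^ (2 * k) \<le> X \<omega> ^ (2 * k)}"
  proof (intro finite_measure_mono subsetI)
    fix \<omega> assume "\<omega> \<in> {\<omega> \<in> space M. y < \<bar>X \<omega>\<bar>}"
    then show "\<omega> \<in> {\<omega> \<in> space M. y ^ (2 * k) \<le> X \<omega> ^ (2 * k)}"
      using y power_mono[of y "\<bar>X \<omega>\<bar>" "2 * k"] by (auto simp: power_even_abs)
  qed measurable
  also have "\<dots> \<le> expectation (\<lambda>\<omega>. X \<omega> ^ (2 * k)) / y ^ (2 * k)"
    using y int by (intro integral_Markov_inequality_measure[where A = "{}"]) auto
  also have "\<dots> = fact (2 * k) / (2 ^ k * fact k) * (\<sigma> / y) ^ (2 * k)"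
  proof -
    have "(\<sigma> / y) ^ (2 * k) = (\<sigma>\<^sup>2) ^ k / y ^ (2 * k)"
      by (simp add: power_divide power_mult)
    then show ?thesis
      unfolding ex using y \<sigma> by (simp add: power_divide)
  qed
  finally show ?thesis .
qed

text \<open>Dyadic subdivisions, in preference to the rationals, are nested and come ordered, so that a walk can
  be run along each of them.\<close>

lemma dyadic_grid_dense:
  fixes t a b :: real
  assumes t: "t \<in> {a..b}"
  obtains j :: "nat \<Rightarrow> nat"
  where "\<And>n. j n \<le> 2 ^ n" "(\<lambda>n. a + real (j n) * (b - a) / 2 ^ n) \<longlonglongrightarrow> t"
proof (cases "a = b")
  case True
  with t show ?thesis by (intro that[of "\<lambda>_. 0"]) auto
next
  case False
  with t have ab: "a < b" by auto
  define j where "j n = nat \<lfloor>(t - a) * 2 ^ n / (b - a)\<rfloor>" for n :: nat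
  have j: "j n \<le> 2 ^ n" "\<bar>a + real (j n) * (b - a) / 2 ^ n - t\<bar> \<le> (b - a) / 2 ^ n" for n
  proof -
    let ?q = "(t - a) * 2 ^ n / (b - a)"
    have q: "0 \<le> ?q" "?q \<le> 2 ^ n"
      using t ab by (auto simp: field_simps)
    then have jq: "real (j n) \<le> ?q" "?q < real (j n) + 1"
      unfolding j_def by linarith+
    have "real (j n) \<le> 2 ^ n" using jq(1) q(2) by (rule order_trans)
    then show "j n \<le> 2 ^ n"
      by (metis of_nat_le_iff of_nat_numeral of_nat_power)
    have "?q * ((b - a) / 2 ^ n) = t - a"
      using ab by simp
    moreover have "real (j n) * ((b - a) / 2 ^ n) \<le> ?q * ((b - a) / 2 ^ n)"
      "?q * ((b - a) / 2 ^ n) \<le> (real (j n) + 1) * ((b - a) / 2 ^ n)"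
      using jq ab by (auto intro!: mult_right_mono simp del: times_divide_eq_right times_divide_eq_left)
    ultimately show "\<bar>a + real (j n) * (b - a) / 2 ^ n - t\<bar> \<le> (b - a) / 2 ^ n"
      by (simp add: algebra_simps add_divide_distrib diff_divide_distrib)
  qed
  have "(\<lambda>n. a + real (j n) * (b - a) / 2 ^ n - t) \<longlonglongrightarrow> 0"
  proof (rule Lim_null_comparison)
    show "\<forall>\<^sub>F n in sequentially. norm (a + real (j n) * (b - a) / 2 ^ n - t) \<le> (b - a) * (1 / 2) ^ n"
      using j(2) by (auto simp: power_divide)
    show "(\<lambda>n. (b - a) * (1 / 2) ^ n) \<longlonglongrightarrow> 0"
      by (intro tendsto_mult_right_zero LIMSEQ_power_zero) simp
  qed
  then have "(\<lambda>n. a + real (j n) * (b - a) / 2 ^ n) \<longlonglongrightarrow> t"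
    by (simp add: LIM_zero_iff)
  with j(1) show ?thesis by (intro that[of j])
qed

locale brownian = prob_space M
  for M :: "'a measure" +
  fixes F :: "real \<Rightarrow> 'a measure" and W :: "real \<Rightarrow> 'a \<Rightarrow> real"
  assumes filtered: "filtered_prob_space M F" and brownian: "brownian_motion M F W"
begin

lemma subalgebra_F: "0 \<le> t \<Longrightarrow> subalgebra M (F t)"
  using filtered by (auto simp: filtered_prob_space_def)

lemma space_F: "0 \<le> t \<Longrightarrow> space (F t) = space M"
  using subalgebra_F by (auto simp: subalgebra_def)

lemma sets_F_subset: "0 \<le> t \<Longrightarrow> sets (F t) \<subseteq> sets M"
  using subalgebra_F by (auto simp: subalgebra_def)

lemma sets_F_mono: "0 \<le> s \<Longrightarrow> s \<le> t \<Longrightarrow> sets (F s) \<subseteq> sets (F t)"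
  using filtered by (auto simp: filtered_prob_space_def subalgebra_def)

lemma measurable_W_F: "0 \<le> s \<Longrightarrow> s \<le> t \<Longrightarrow> W s \<in> borel_measurable (F t)"
  using brownian filtered unfolding brownian_motion_def filtered_prob_space_def
  by (meson measurable_from_subalg order_trans)

lemma measurable_W: "0 \<le> t \<Longrightarrow> W t \<in> borel_measurable M"
  using measurable_from_subalg[OF subalgebra_F measurable_W_F[of t t]] by auto

lemma continuous_W: "\<omega> \<in> space M \<Longrightarrow> continuous_on {0..} (\<lambda>t. W t \<omega>)"
  using brownian by (auto simp: brownian_motion_def)

lemma distributed_increment:
  "0 \<le> s \<Longrightarrow> s < t \<Longrightarrow> distributed M lborel (\<lambda>\<omega>. W t \<omega> - W s \<omega>)
     (\<lambda>x. ennreal (normal_density 0 (sqrt (t - s)) x))"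
  using brownian by (auto simp: brownian_motion_def)

lemma prob_increment:
  assumes "0 \<le> s" "s < t" "A \<in> sets (F s)" "H \<in> sets borel"
  shows "prob (A \<inter> {\<omega> \<in> space M. W t \<omega> - W s \<omega> \<in> H}) =
    prob A * prob {\<omega> \<in> space M. W t \<omega> - W s \<omega> \<in> H}"
proof -
  have "{\<omega> \<in> space M. W t \<omega> - W s \<omega> \<in> H} \<in>
      sets (vimage_algebra (space M) (\<lambda>\<omega>. W t \<omega> - W s \<omega>) borel)"
    using in_vimage_algebra[OF assms(4), of "\<lambda>\<omega>. W t \<omega> - W s \<omega>" "space M"]
    by (simp add: vimage_def Int_def conj_commute)
  then show ?thesis
    using brownian assms by (auto simp: brownian_motion_def intro!: indep_setD)
qed

lemma prob_increment_symmetric: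
  assumes "0 \<le> s" "s \<le> t" "A \<in> sets (F s)"
  shows "prob (A \<inter> {\<omega> \<in> space M. x < W t \<omega> - W s \<omega>}) =
    prob (A \<inter> {\<omega> \<in> space M. W t \<omega> - W s \<omega> < - x})"
proof (cases "s = t")
  case False
  with assms have "s < t" by simp
  then show ?thesis
    using prob_increment[OF assms(1) _ assms(3), of t "{x<..}"]
      prob_increment[OF assms(1) _ assms(3), of t "{..< - x}"]
      prob_normal_symmetric[OF distributed_increment[OF assms(1)], of t x]
    by simp
qed simp

lemma symmetric_walk_brownian:
  assumes u: "0 \<le> u 0" "mono u" and c: "c = 1 \<or> c = - 1"
  shows "symmetric_walk M (\<lambda>j. F (u j)) (\<lambda>j \<omega>. c * (W (u j) \<omega> - W (u 0) \<omega>)) m"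
proof
  have pos: "0 \<le> u j" for j
    using u(1) monoD[OF u(2), of 0 j] by simp
  show "subalgebra M (F (u j))" for j
    by (rule subalgebra_F[OF pos])
  show "sets (F (u i)) \<subseteq> sets (F (u j))" if "i \<le> j" for i j
    using that by (intro sets_F_mono pos monoD[OF u(2)])
  show "(\<lambda>\<omega>. c * (W (u i) \<omega> - W (u 0) \<omega>)) \<in> borel_measurable (F (u j))" if "i \<le> j" for i j
    using that
    by (intro borel_measurable_times borel_measurable_diff borel_measurable_const
        measurable_W_F pos monoD[OF u(2)]) auto
  fix j A x assume j: "j \<le> m" and A: "A \<in> sets (F (u j))"
  have *: "c * (W (u m) \<omega> - W (u 0) \<omega>) - c * (W (u j) \<omega> - W (u 0) \<omega>) =
      c * (W (u m) \<omega> - W (u j) \<omega>)" for \<omega>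
    by (simp add: algebra_simps)
  have "prob (A \<inter> {\<omega> \<in> space M. y < W (u m) \<omega> - W (u j) \<omega>}) =
      prob (A \<inter> {\<omega> \<in> space M. W (u m) \<omega> - W (u j) \<omega> < - y})" for y
    using j by (intro prob_increment_symmetric pos monoD[OF u(2)] A)
  from this[of x] this[of "- x"] c show "prob (A \<inter> {\<omega> \<in> space M.
      x < c * (W (u m) \<omega> - W (u 0) \<omega>) - c * (W (u j) \<omega> - W (u 0) \<omega>)}) =
    prob (A \<inter> {\<omega> \<in> space M.
      c * (W (u m) \<omega> - W (u 0) \<omega>) - c * (W (u j) \<omega> - W (u 0) \<omega>) < - x})"
    unfolding * by (auto simp: minus_less_iff less_minus_iff)
qed

text \<open>Levy's inequality along finer and finer dyadic subdivisions: paths are continuous and the condition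
  is open, so the event is the increasing limit of its dyadic versions. The sign \<open>c\<close> covers upward and
  downward excursions.\<close>

lemma brownian_maximal_inequality:
  assumes ab: "0 \<le> a" "a < b" and c: "c = 1 \<or> c = - 1"
  shows "{\<omega> \<in> space M. \<exists>u\<in>{a..b}. x < c * (W u \<omega> - W a \<omega>)} \<in> sets M" (is "?A \<in> _")
    and "prob {\<omega> \<in> space M. \<exists>u\<in>{a..b}. x < c * (W u \<omega> - W a \<omega>)} \<le>
      2 * prob {\<omega> \<in> space M. x < c * (W b \<omega> - W a \<omega>)}" (is "_ \<le> ?p")
proof -
  define u where "u n j = a + real j * (b - a) / 2 ^ n" for n j :: nat
  define D where "D n = {\<omega> \<in> space M. \<exists>j\<le>2^n. x < c * (W (u n j) \<omega> - W (u n 0) \<omega>)}" for n :: nat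
  have u: "0 \<le> u n 0" "mono (u n)" "u n 0 = a" "u n (2 ^ n) = b" "0 \<le> u n j" for n j
    using ab by (auto simp: u_def intro!: monoI divide_right_mono mult_right_mono)
  have ub: "u n j \<in> {a..b}" if "j \<le> 2 ^ n" for n j
    using monoD[OF u(2), of 0 j n] monoD[OF u(2), of j "2 ^ n" n] that by (simp add: u)
  have D: "D n \<in> sets M" for n
  proof -
    have [measurable]: "W (u n j) \<in> borel_measurable M" for j
      by (rule measurable_W[OF u(5)])
    have "{\<omega> \<in> space M. \<exists>j\<in>{..2^n}. x < c * (W (u n j) \<omega> - W (u n 0) \<omega>)} \<in> sets M"
      by measurable
    then show ?thesis by (simp add: D_def Bex_def)
  qed
  have bound: "prob (D n) \<le> ?p" for n
  proof -
    interpret symmetric_walk M "\<lambda>j. F (u n j)" "\<lambda>j \<omega>. c * (W (u n j) \<omega> - W (u n 0) \<omega>)" "2 ^ n"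
      by (rule symmetric_walk_brownian[OF u(1,2) c])
    show ?thesis
      using levy_maximal_inequality[of x] by (simp add: D_def u)
  qed
  have incr: "incseq D"
  proof (rule incseq_SucI)
    fix n
    have "u n j = u (Suc n) (2 * j)" for j
      by (simp add: u_def)
    then show "D n \<subseteq> D (Suc n)"
      unfolding D_def u(3) by (force intro: exI[of _ "2 * j" for j])
  qed
  have A: "?A = (\<Union>n. D n)"
  proof (intro equalityI subsetI)
    fix \<omega> assume "\<omega> \<in> ?A"
    then obtain t where \<omega>: "\<omega> \<in> space M" and t: "t \<in> {a..b}" "x < c * (W t \<omega> - W a \<omega>)"
      by auto
    obtain j where j: "\<And>n. j n \<le> 2 ^ n" "(\<lambda>n. u n (j n)) \<longlonglongrightarrow> t"
      using dyadic_grid_dense[of t a b] t(1) unfolding u_def by blast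
    have "(\<lambda>n. W (u n (j n)) \<omega>) \<longlonglongrightarrow> W t \<omega>"
      by (rule continuous_on_tendsto_compose[OF continuous_W[OF \<omega>] j(2)]) (use t ab u(5) in auto)
    then have "(\<lambda>n. c * (W (u n (j n)) \<omega> - W a \<omega>)) \<longlonglongrightarrow> c * (W t \<omega> - W a \<omega>)"
      by (intro tendsto_intros)
    from order_tendstoD(1)[OF this t(2)] obtain n where "x < c * (W (u n (j n)) \<omega> - W a \<omega>)"
      by (auto simp: eventually_sequentially)
    then show "\<omega> \<in> (\<Union>n. D n)"
      using \<omega> j(1)[of n] by (auto simp: D_def u(3))
  qed (use ub in \<open>auto simp: D_def u(3)\<close>)
  show "?A \<in> sets M"
    unfolding A using D by auto
  have "(\<lambda>n. prob (D n)) \<longlonglongrightarrow> prob (\<Union>n. D n)"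
    using D incr by (intro finite_Lim_measure_incseq) auto
  then show "prob ?A \<le> ?p"
    unfolding A by (rule LIMSEQ_le_const2) (use bound in auto)
qed

lemma prob_oscillation_le:
  assumes ab: "0 \<le> a" "a < b" and x: "0 < x"
  shows "{\<omega> \<in> space M. \<exists>u\<in>{a..b}. x < \<bar>W u \<omega> - W a \<omega>\<bar>} \<in> sets M" (is "?A \<in> _")
    and "prob {\<omega> \<in> space M. \<exists>u\<in>{a..b}. x < \<bar>W u \<omega> - W a \<omega>\<bar>} \<le>
      4 * (fact (2 * k) / (2 ^ k * fact k) * (sqrt (b - a) / x) ^ (2 * k))" (is "_ \<le> 4 * ?t")
proof -
  let ?U = "\<lambda>c. {\<omega> \<in> space M. \<exists>u\<in>{a..b}. x < c * (W u \<omega> - W a \<omega>)}"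
  note mx = brownian_maximal_inequality[OF ab]
  have A: "?A = ?U 1 \<union> ?U (- 1)"
  proof -
    have "x < \<bar>y\<bar> \<longleftrightarrow> x < 1 * y \<or> x < - 1 * y" for y :: real by auto
    then show ?thesis by blast
  qed
  show "?A \<in> sets M"
    unfolding A by (intro sets.Un mx(1)) auto
  have [measurable]: "W a \<in> borel_measurable M" "W b \<in> borel_measurable M"
    using ab by (auto intro: measurable_W)
  have le: "prob {\<omega> \<in> space M. x < c * (W b \<omega> - W a \<omega>)} \<le> ?t" if "c = 1 \<or> c = - 1" for c
  proof -
    have "prob {\<omega> \<in> space M. x < c * (W b \<omega> - W a \<omega>)} \<le>
        prob {\<omega> \<in> space M. x < \<bar>W b \<omega> - W a \<omega>\<bar>}"
      using that by (intro finite_measure_mono) auto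
    also have "\<dots> \<le> ?t"
      using ab x by (intro prob_normal_tail[OF distributed_increment]) auto
    finally show ?thesis .
  qed
  have "prob ?A \<le> prob (?U 1) + prob (?U (- 1))"
    unfolding A by (intro measure_Un_le mx(1)) auto
  also have "\<dots> \<le> 2 * ?t + 2 * ?t"
    using mx(2)[of 1 x] mx(2)[of "-1" x] le[of 1] le[of "-1"] by linarith
  finally show "prob ?A \<le> 4 * ?t" by linarith
qed

end

section \<open>Enlarging the filtration by the initial value\<close>

text \<open>The hitting times depend on the initial value, which need not be measurable for the given filtration,
  and the given sigma-algebras together with the initial value need not be independent of the later
  increments, because they may contain more than the past of \<open>W\<close>. The new sigma-algebra at time \<open>s\<close> is
  generated by the intersections of an event of \<open>Y\<close> with an event that is known at time \<open>s\<close> and also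
  belongs to the sigma-algebra of the whole path of \<open>W\<close>. On such intersections the independence of
  \<open>Y\<close> from the path and that of the past from the increment combine, and they form a system that is
  stable under intersections.\<close>

lemma (in prob_space) brownian_motion_initial_enlargement:
  fixes Y :: "'a \<Rightarrow> real" and W :: "real \<Rightarrow> 'a \<Rightarrow> real"
  assumes filt: "filtered_prob_space M F" and bm: "brownian_motion M F W"
    and indep: "indep_set (sets (vimage_algebra (space M) Y borel))
      (sets (vimage_algebra (space M) (\<lambda>\<omega>. \<lambda>t\<in>{0..}. W t \<omega>) (PiM {0..} (\<lambda>_. borel))))"
  shows "\<exists>F'. filtered_prob_space M F' \<and> brownian_motion M F' W \<and>
    (\<forall>t\<ge>0. Y \<in> borel_measurable (F' t))"
proof -
  interpret brownian M F W
    using filt bm by unfold_locales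
  define \<Sigma>Y where "\<Sigma>Y = vimage_algebra (space M) Y (borel :: real measure)"
  define \<Sigma>W where "\<Sigma>W = vimage_algebra (space M) (\<lambda>\<omega>. \<lambda>t\<in>{0..}. W t \<omega>) (PiM {0..} (\<lambda>_. borel :: real measure))"
  define P where "P s = {A \<inter> B | A B. A \<in> sets \<Sigma>Y \<and> B \<in> sets \<Sigma>W \<and> B \<in> sets (F s)}" for s
  define F' where "F' s = sigma (space M) (P s)" for s
  have ind: "indep_set (sets \<Sigma>Y) (sets \<Sigma>W)"
    using indep by (simp add: \<Sigma>Y_def \<Sigma>W_def)
  have Y_M: "sets \<Sigma>Y \<subseteq> sets M" and W_M: "sets \<Sigma>W \<subseteq> sets M"
    using indep_setD_ev1[OF ind] indep_setD_ev2[OF ind] .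
  have sp: "space \<Sigma>Y = space M" "space \<Sigma>W = space M"
    by (auto simp: \<Sigma>Y_def \<Sigma>W_def)
  have W_meas: "W t \<in> borel_measurable \<Sigma>W" if "0 \<le> t" for t
  proof -
    have "(\<lambda>\<omega>. \<lambda>t\<in>{0..}. W t \<omega>) \<in> measurable \<Sigma>W (PiM {0..} (\<lambda>_. borel))"
      unfolding \<Sigma>W_def by (rule measurable_vimage_algebra1) (auto simp: space_PiM)
    from measurable_compose[OF this measurable_component_singleton[of t]] that
    show ?thesis by simp
  qed
  have Y_meas: "Y \<in> borel_measurable \<Sigma>Y"
    unfolding \<Sigma>Y_def by (rule measurable_vimage_algebra1) auto
  have P_M: "P s \<subseteq> sets M" for s
    using Y_M W_M by (auto simp: P_def)
  have P_sub: "P s \<subseteq> Pow (space M)" for s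
    using P_M sets.space_closed by (rule order_trans)
  have space_F': "space (F' s) = space M" for s
    by (simp add: F'_def space_measure_of[OF P_sub])
  have sets_F': "sets (F' s) = sigma_sets (space M) (P s)" for s
    by (simp add: F'_def sets_measure_of[OF P_sub])
  have F'_M: "sets (F' s) \<subseteq> sets M" for s
    unfolding sets_F' by (rule sets.sigma_sets_subset[OF P_M])
  have P_mono: "P s \<subseteq> P t" if "0 \<le> s" "s \<le> t" for s t
    using sets_F_mono[OF that] by (auto simp: P_def)
  have filt': "filtered_prob_space M F'"
    unfolding filtered_prob_space_def subalgebra_def space_F'
    using prob_space_axioms F'_M sigma_sets_mono'[OF P_mono] by (simp add: sets_F')
  have Y_F': "Y \<in> borel_measurable (F' t)" if t: "0 \<le> t" for t
  proof (rule measurableI)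
    fix A :: "real set" assume A: "A \<in> sets borel"
    have "Y -` A \<inter> space M = (Y -` A \<inter> space \<Sigma>Y) \<inter> space M"
      by (simp add: sp)
    also have "\<dots> \<in> P t"
      unfolding P_def using measurable_sets[OF Y_meas A] sets.top[of \<Sigma>W] sets.top[of "F t"]
      unfolding sp space_F[OF t] by blast
    finally show "Y -` A \<inter> space (F' t) \<in> sets (F' t)"
      by (auto simp: space_F' sets_F')
  qed simp
  have W_F': "W t \<in> borel_measurable (F' t)" if t: "0 \<le> t" for t
  proof (rule measurableI)
    fix A :: "real set" assume A: "A \<in> sets borel"
    have "W t -` A \<inter> space M = space M \<inter> (W t -` A \<inter> space M)"
      by auto
    also have "\<dots> \<in> P t"
      unfolding P_def using measurable_sets[OF W_meas[OF t] A] sets.top[of \<Sigma>Y]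
        measurable_sets[OF measurable_W_F[OF t order_refl] A]
      unfolding sp space_F[OF t] by blast
    finally show "W t -` A \<inter> space (F' t) \<in> sets (F' t)"
      by (auto simp: space_F' sets_F')
  qed simp
  have indep': "indep_set (sets (F' s)) (sets (vimage_algebra (space M) (\<lambda>\<omega>. W t \<omega> - W s \<omega>) borel))"
    if st: "0 \<le> s" "s < t" for s t
  proof -
    let ?V = "vimage_algebra (space M) (\<lambda>\<omega>. W t \<omega> - W s \<omega>) (borel :: real measure)"
    have F_V: "indep_set (sets (F s)) (sets ?V)"
      using bm st by (auto simp: brownian_motion_def)
    have V_W: "sets ?V \<subseteq> sets \<Sigma>W"
    proof -
      have [measurable]: "W t \<in> borel_measurable \<Sigma>W" "W s \<in> borel_measurable \<Sigma>W"
        using st by (auto intro: W_meas)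
      have "(\<lambda>\<omega>. W t \<omega> - W s \<omega>) \<in> borel_measurable \<Sigma>W" by measurable
      from measurable_sets[OF this] show ?thesis
        using sets_vimage_algebra2[of "\<lambda>\<omega>. W t \<omega> - W s \<omega>" "space M" "borel :: real measure"]
        by (auto simp: sp)
    qed
    have "indep_set (P s) (sets ?V)"
    proof (rule indep_setI)
      show "P s \<subseteq> events" "sets ?V \<subseteq> events"
        using P_M V_W W_M by auto
      fix a c assume "a \<in> P s" and c: "c \<in> sets ?V"
      then obtain A B where a: "a = A \<inter> B" and A: "A \<in> sets \<Sigma>Y" and B: "B \<in> sets \<Sigma>W" "B \<in> sets (F s)"
        by (auto simp: P_def)
      have "prob (a \<inter> c) = prob (A \<inter> (B \<inter> c))"
        by (simp add: a Int_assoc)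
      also have "\<dots> = prob A * prob (B \<inter> c)"
        using V_W c B by (intro indep_setD[OF ind A]) auto
      also have "prob (B \<inter> c) = prob B * prob c"
        by (rule indep_setD[OF F_V B(2) c])
      also have "prob A * (prob B * prob c) = prob a * prob c"
        using indep_setD[OF ind A B(1)] by (simp add: a)
      finally show "prob (a \<inter> c) = prob a * prob c" .
    qed
    moreover have "Int_stable (P s)"
    proof (rule Int_stableI)
      fix a b assume "a \<in> P s" "b \<in> P s"
      then obtain A B A' B' where "a = A \<inter> B" "b = A' \<inter> B'" "A \<inter> A' \<in> sets \<Sigma>Y"
        "B \<inter> B' \<in> sets \<Sigma>W" "B \<inter> B' \<in> sets (F s)"
        unfolding P_def by blast
      moreover from this have "a \<inter> b = (A \<inter> A') \<inter> (B \<inter> B')" by auto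
      ultimately show "a \<inter> b \<in> P s"
        unfolding P_def by blast
    qed
    ultimately have "indep_set (sigma_sets (space M) (P s)) (sigma_sets (space M) (sets ?V))"
      by (intro indep_set_sigma_sets) (auto simp: Int_stable_def)
    then show ?thesis
      using sets.sigma_sets_eq[of ?V] by (simp add: sets_F')
  qed
  have "brownian_motion M F' W"
    using bm W_F' indep' by (simp add: brownian_motion_def)
  with filt' Y_F' show ?thesis by blast
qed

section \<open>Increments of a monotone function with a bounded weak derivative\<close>

text \<open>The tent of mass \<open>1\<close> on \<open>[0, 2\<epsilon>]\<close>, as a second difference of \<open>max 0 x\<close>. Its primitive is the same
  second difference of \<open>(max 0 x)\<^sup>2 / 2\<close>, which is continuously differentiable across the break
  points.\<close>

definition tent :: "real \<Rightarrow> real \<Rightarrow> real" where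
  "tent \<epsilon> x = (max 0 x - 2 * max 0 (x - \<epsilon>) + max 0 (x - 2 * \<epsilon>)) / \<epsilon>\<^sup>2"

definition ramp :: "real \<Rightarrow> real \<Rightarrow> real" where
  "ramp \<epsilon> x = ((max 0 x)\<^sup>2 - 2 * (max 0 (x - \<epsilon>))\<^sup>2 + (max 0 (x - 2 * \<epsilon>))\<^sup>2) / (2 * \<epsilon>\<^sup>2)"

lemma has_real_derivative_max_sq:
  "((\<lambda>x. (max 0 (x - c))\<^sup>2) has_real_derivative 2 * max 0 (x - c)) (at x)"
proof -
  consider "x < c" | "x = c" | "c < x" by linarith
  then show ?thesis
  proof cases
    case 1
    have "((\<lambda>x. 0) has_real_derivative 2 * max 0 (x - c)) (at x)"
      using 1 by simp
    then show ?thesis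
      by (rule has_field_derivative_transform_within_open[of _ _ _ "{..<c}"]) (use 1 in auto)
  next
    case 2
    have "((\<lambda>y. (max 0 (y - c))\<^sup>2) has_real_derivative 0) (at c)"
      unfolding has_field_derivative_iff
    proof (rule Lim_null_comparison)
      show "\<forall>\<^sub>F y in at c. norm (((max 0 (y - c))\<^sup>2 - (max 0 (c - c))\<^sup>2) / (y - c)) \<le> \<bar>y - c\<bar>"
        by (rule eventuallyI) (auto simp: max_def power2_eq_square)
      show "((\<lambda>y. \<bar>y - c\<bar>) \<longlongrightarrow> 0) (at c)"
        by (auto intro!: tendsto_eq_intros)
    qed
    with 2 show ?thesis by simp
  next
    case 3
    have "((\<lambda>x. (x - c)\<^sup>2) has_real_derivative 2 * max 0 (x - c)) (at x)"
      using 3 by (auto intro!: derivative_eq_intros)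
    then show ?thesis
      by (rule has_field_derivative_transform_within_open[of _ _ _ "{c<..}"]) (use 3 in auto)
  qed
qed

lemma has_real_derivative_ramp:
  assumes "0 < \<epsilon>"
  shows "((\<lambda>x. ramp \<epsilon> (x - c)) has_real_derivative tent \<epsilon> (x - c)) (at x)"
proof -
  have eq: "x - c - d = x - (c + d)" for x d :: real by simp
  have "((\<lambda>x. ramp \<epsilon> (x - c)) has_real_derivative (2 * max 0 (x - c)
      - 2 * (2 * max 0 (x - (c + \<epsilon>))) + 2 * max 0 (x - (c + 2 * \<epsilon>))) / (2 * \<epsilon>\<^sup>2)) (at x)"
    unfolding ramp_def eq
    by (intro DERIV_cdivide DERIV_add DERIV_diff DERIV_cmult has_real_derivative_max_sq)
  also have "(2 * max 0 (x - c) - 2 * (2 * max 0 (x - (c + \<epsilon>))) + 2 * max 0 (x - (c + 2 * \<epsilon>))) /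
      (2 * \<epsilon>\<^sup>2) = tent \<epsilon> (x - c)"
    unfolding tent_def eq using assms by (simp add: field_simps)
  finally show ?thesis .
qed

lemma continuous_on_hat: "continuous_on A (\<lambda>x. tent \<epsilon> (x - c))"
  unfolding tent_def by (cases "\<epsilon> = 0") (auto intro!: continuous_intros)

lemma tent_nonneg: "0 < \<epsilon> \<Longrightarrow> 0 \<le> tent \<epsilon> x"
  by (auto simp: tent_def max_def intro!: divide_nonneg_pos)

lemma tent_eq_0: "0 < \<epsilon> \<Longrightarrow> x \<notin> {0..2 * \<epsilon>} \<Longrightarrow> tent \<epsilon> x = 0"
  by (auto simp: tent_def max_def)

lemma ramp_eq_0: "0 < \<epsilon> \<Longrightarrow> x \<le> 0 \<Longrightarrow> ramp \<epsilon> x = 0"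
  by (auto simp: ramp_def max_def)

lemma ramp_eq_1: "0 < \<epsilon> \<Longrightarrow> 2 * \<epsilon> \<le> x \<Longrightarrow> ramp \<epsilon> x = 1"
  by (auto simp: ramp_def max_def field_simps power2_eq_square)

lemma ramp_mono:
  assumes "0 < \<epsilon>" "x \<le> y"
  shows "ramp \<epsilon> x \<le> ramp \<epsilon> y"
  using assms has_real_derivative_ramp[OF assms(1), of 0] tent_nonneg[OF assms(1)]
  by (intro DERIV_nonneg_imp_nondecreasing[of x y "ramp \<epsilon>"]) (auto)

lemma ramp_bounds:
  assumes "0 < \<epsilon>"
  shows "0 \<le> ramp \<epsilon> x" "ramp \<epsilon> x \<le> 1"
proof -
  show "0 \<le> ramp \<epsilon> x"
    using ramp_mono[OF assms, of "min 0 x" x] ramp_eq_0[OF assms, of "min 0 x"] by simp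
  show "ramp \<epsilon> x \<le> 1"
    using ramp_mono[OF assms, of x "max (2 * \<epsilon>) x"] ramp_eq_1[OF assms, of "max (2 * \<epsilon>) x"] by simp
qed

lemma tent_integral:
  assumes "0 < \<epsilon>" "0 < c" "c + 2 * \<epsilon> < b"
  shows "integrable lborel (\<lambda>x. indicator {0<..<b} x * tent \<epsilon> (x - c))"
    and "(LINT x|lborel. indicator {0<..<b} x * tent \<epsilon> (x - c)) = 1"
proof -
  have eq: "indicator {0<..<b} x * tent \<epsilon> (x - c) = tent \<epsilon> (x - c) * indicator {c..c + 2 * \<epsilon>} x" for x
    using tent_eq_0[OF assms(1), of "x - c"] assms by (auto simp: indicator_def)
  have "has_bochner_integral lborel (\<lambda>x. tent \<epsilon> (x - c) * indicator {c..c + 2 * \<epsilon>} x)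
      (ramp \<epsilon> (c + 2 * \<epsilon> - c) - ramp \<epsilon> (c - c))"
    using assms has_real_derivative_ramp[OF assms(1), of c] continuous_on_hat[of _ \<epsilon> c]
    by (intro has_bochner_integral_FTC_Icc_nonneg[where F = "\<lambda>x. ramp \<epsilon> (x - c)"])
      (auto intro: tent_nonneg borel_measurable_continuous_onI)
  then have "has_bochner_integral lborel (\<lambda>x. tent \<epsilon> (x - c) * indicator {c..c + 2 * \<epsilon>} x) 1"
    using assms by (simp add: ramp_eq_0 ramp_eq_1)
  then show "integrable lborel (\<lambda>x. indicator {0<..<b} x * tent \<epsilon> (x - c))"
    "(LINT x|lborel. indicator {0<..<b} x * tent \<epsilon> (x - c)) = 1"
    unfolding eq by (auto simp: has_bochner_integral_iff)
qed

text \<open>Test the weak derivative with a ramp up on \<open>[s, s + 2\<epsilon>]\<close> and a ramp down on \<open>[t, t + 2\<epsilon>]\<close>. Its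
  derivative averages \<open>L\<close> near \<open>s\<close> and near \<open>t\<close>, and monotonicity compares the two averages with the
  values \<open>L (s + 2\<epsilon>)\<close> and \<open>L t\<close>.\<close>

lemma weak_derivative_increment_approx:
  assumes H1: "H1_weak_deriv 0 b L L'"
    and mono: "\<And>x y. 0 < x \<Longrightarrow> x \<le> y \<Longrightarrow> y < b \<Longrightarrow> L x \<le> L y"
    and bound: "\<And>x. 0 < x \<Longrightarrow> x < b \<Longrightarrow> \<bar>L x\<bar> \<le> C"
    and K: "0 \<le> K" "AE x in lborel. s \<le> x \<longrightarrow> x < b \<longrightarrow> L' x \<le> K"
    and st: "0 < s" "s \<le> t" and \<epsilon>: "0 < \<epsilon>" "t + 2 * \<epsilon> < b"
  shows "L t - L (s + 2 * \<epsilon>) \<le> K * (t + 2 * \<epsilon> - s)"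
proof -
  define \<phi> where "\<phi> x = ramp \<epsilon> (x - s) - ramp \<epsilon> (x - t)" for x
  define \<phi>' where "\<phi>' x = tent \<epsilon> (x - s) - tent \<epsilon> (x - t)" for x
  have \<phi>0: "\<phi> x = 0" if "x \<notin> {s..t + 2 * \<epsilon>}" for x
    using that st \<epsilon> by (auto simp: \<phi>_def ramp_eq_0 ramp_eq_1)
  have \<phi>1: "0 \<le> \<phi> x" "\<phi> x \<le> 1" for x
    using ramp_mono[OF \<epsilon>(1), of "x - t" "x - s"] ramp_bounds[OF \<epsilon>(1), of "x - t"]
      ramp_bounds[OF \<epsilon>(1), of "x - s"] st by (auto simp: \<phi>_def)
  have cont: "continuous_on UNIV \<phi>'"
    unfolding \<phi>'_def by (intro continuous_intros continuous_on_hat)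
  have "C1_test_fun 0 b \<phi> \<phi>'"
    unfolding C1_test_fun_def
  proof (intro conjI allI cont)
    show "(\<phi> has_real_derivative \<phi>' x) (at x)" for x
      unfolding \<phi>_def \<phi>'_def
      by (intro DERIV_diff has_real_derivative_ramp \<epsilon>)
    show "\<exists>c d. 0 < c \<and> d < b \<and> (\<forall>x. x \<notin> {c..d} \<longrightarrow> \<phi> x = 0)"
      using \<phi>0 st \<epsilon> by blast
  qed
  then have parts: "(LBINT x:{0<..<b}. L x * \<phi>' x) = - (LBINT x:{0<..<b}. L' x * \<phi> x)"
    using H1 by (simp add: H1_weak_deriv_def)
  have "(LBINT x:{0<..<b}. L x * \<phi>' x) \<le> L (s + 2 * \<epsilon>) - L t"
  proof -
    let ?i = "indicator {0<..<b} :: real \<Rightarrow> real"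
    let ?g = "\<lambda>x. L (s + 2 * \<epsilon>) * (?i x * tent \<epsilon> (x - s)) - L t * (?i x * tent \<epsilon> (x - t))"
    have s: "s + 2 * \<epsilon> < b" "0 < t" using st \<epsilon> by auto
    note hs = tent_integral[OF \<epsilon>(1) st(1) s(1)] and ht = tent_integral[OF \<epsilon>(1) s(2) \<epsilon>(2)]
    have [measurable]: "(\<lambda>x. ?i x * L x) \<in> borel_measurable lborel"
      using H1 by (simp add: H1_weak_deriv_def L2_on_def set_borel_measurable_def)
    have [measurable]: "\<phi>' \<in> borel_measurable lborel"
      using borel_measurable_continuous_onI[OF cont] by simp
    have "(LBINT x:{0<..<b}. L x * \<phi>' x) = (LINT x|lborel. (?i x * L x) * \<phi>' x)"
      by (simp add: set_lebesgue_integral_def mult.assoc)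
    also have "\<dots> \<le> (LINT x|lborel. ?g x)"
    proof (rule integral_mono)
      show "integrable lborel ?g"
        using hs(1) ht(1) by (intro Bochner_Integration.integrable_diff integrable_mult_right) auto
      show "integrable lborel (\<lambda>x. (?i x * L x) * \<phi>' x)"
      proof (rule Bochner_Integration.integrable_bound)
        show "integrable lborel (\<lambda>x. C * (?i x * tent \<epsilon> (x - s)) + C * (?i x * tent \<epsilon> (x - t)))"
          using hs(1) ht(1) by (intro Bochner_Integration.integrable_add integrable_mult_right) auto
        have "norm ((?i x * L x) * \<phi>' x) \<le>
            norm (C * (?i x * tent \<epsilon> (x - s)) + C * (?i x * tent \<epsilon> (x - t)))" for x
        proof (cases "0 < x \<and> x < b")
          case True
          have "\<bar>L x\<bar> * \<bar>\<phi>' x\<bar> \<le> C * (tent \<epsilon> (x - s) + tent \<epsilon> (x - t))"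
            using bound[of x] True tent_nonneg[OF \<epsilon>(1), of "x - s"] tent_nonneg[OF \<epsilon>(1), of "x - t"]
            by (intro mult_mono) (auto simp: \<phi>'_def)
          then show ?thesis using True by (simp add: abs_mult distrib_left)
        qed simp
        then show "AE x in lborel. norm ((?i x * L x) * \<phi>' x) \<le>
            norm (C * (?i x * tent \<epsilon> (x - s)) + C * (?i x * tent \<epsilon> (x - t)))" by simp
      qed measurable
      fix x
      show "(?i x * L x) * \<phi>' x \<le> ?g x"
      proof (cases "0 < x \<and> x < b")
        case True
        have "L x * tent \<epsilon> (x - s) \<le> L (s + 2 * \<epsilon>) * tent \<epsilon> (x - s)"
          using mono[of x "s + 2 * \<epsilon>"] True s tent_nonneg[OF \<epsilon>(1), of "x - s"]
            tent_eq_0[OF \<epsilon>(1), of "x - s"]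
          by (cases "x \<le> s + 2 * \<epsilon>") (auto intro: mult_right_mono)
        moreover have "L t * tent \<epsilon> (x - t) \<le> L x * tent \<epsilon> (x - t)"
          using mono[of t x] True s tent_nonneg[OF \<epsilon>(1), of "x - t"]
            tent_eq_0[OF \<epsilon>(1), of "x - t"]
          by (cases "t \<le> x") (auto intro: mult_right_mono)
        ultimately show ?thesis
          using True by (simp add: \<phi>'_def right_diff_distrib)
      qed simp
    qed
    also have "\<dots> = L (s + 2 * \<epsilon>) - L t"
      using hs ht by simp
    finally show ?thesis .
  qed
  moreover have "(LBINT x:{0<..<b}. L' x * \<phi> x) \<le> K * (t + 2 * \<epsilon> - s)"
  proof -
    have "(LBINT x:{0<..<b}. L' x * \<phi> x) \<le> (LINT x|lborel. K * indicator {s..t + 2 * \<epsilon>} x)"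
      unfolding set_lebesgue_integral_def
    proof (rule integral_mono_AE')
      show "integrable lborel (\<lambda>x. K * indicator {s..t + 2 * \<epsilon>} x)"
        by (intro integrable_mult_right integrable_real_indicator)
          (auto simp: emeasure_lborel_Icc_eq)
      show "AE x in lborel. indicator {0<..<b} x *\<^sub>R (L' x * \<phi> x) \<le> K * indicator {s..t + 2 * \<epsilon>} x"
        using K(2)
      proof eventually_elim
        case (elim x)
        show ?case
        proof (cases "x \<in> {s..t + 2 * \<epsilon>}")
          case True
          then have "L' x * \<phi> x \<le> K * \<phi> x"
            using elim \<epsilon> \<phi>1 by (intro mult_right_mono) auto
          also have "\<dots> \<le> K * 1"
            using K \<phi>1 by (intro mult_left_mono) auto
          finally show ?thesis using True K by (simp add: indicator_def)
        qed (simp add: \<phi>0)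
      qed
    qed (use K in auto)
    also have "\<dots> = K * (t + 2 * \<epsilon> - s)"
      using st \<epsilon> by simp
    finally show ?thesis .
  qed
  ultimately show ?thesis
    using parts by simp
qed

lemma weak_derivative_increment_le:
  assumes H1: "H1_weak_deriv 0 b L L'"
    and mono: "\<And>x y. 0 < x \<Longrightarrow> x \<le> y \<Longrightarrow> y < b \<Longrightarrow> L x \<le> L y"
    and bound: "\<And>x. 0 < x \<Longrightarrow> x < b \<Longrightarrow> \<bar>L x\<bar> \<le> C"
    and cont: "continuous_on {0<..<b} L"
    and K: "0 \<le> K" "AE x in lborel. s \<le> x \<longrightarrow> x < b \<longrightarrow> L' x \<le> K"
    and st: "0 < s" "s \<le> t" "t < b"
  shows "L t - L s \<le> K * (t - s)"
proof (rule tendsto_le)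
  show "((\<lambda>\<epsilon>. L t - L (s + 2 * \<epsilon>)) \<longlongrightarrow> L t - L s) (at_right 0)"
  proof (intro tendsto_diff tendsto_const)
    have "isCont L s"
      using cont st by (simp add: continuous_on_eq_continuous_at)
    moreover have "((\<lambda>\<epsilon>. s + 2 * \<epsilon>) \<longlongrightarrow> s) (at_right 0)"
      by (auto intro!: tendsto_eq_intros)
    ultimately show "((\<lambda>\<epsilon>. L (s + 2 * \<epsilon>)) \<longlongrightarrow> L s) (at_right 0)"
      by (rule isCont_tendsto_compose)
  qed
  show "((\<lambda>\<epsilon>. K * (t + 2 * \<epsilon> - s)) \<longlongrightarrow> K * (t - s)) (at_right 0)"
    by (auto intro!: tendsto_eq_intros)
  have "\<forall>\<^sub>F \<epsilon> in at_right 0. \<epsilon> < (b - t) / 2"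
    using st by (intro eventually_at_right_less[THEN eventually_mono] eventually_at_right_field[THEN iffD2]) (auto intro!: exI[of _ "(b - t) / 2"])
  moreover have "\<forall>\<^sub>F \<epsilon> in at_right 0. (0::real) < \<epsilon>"
    by (rule eventually_at_right_less)
  ultimately show "\<forall>\<^sub>F \<epsilon> in at_right 0. L t - L (s + 2 * \<epsilon>) \<le> K * (t + 2 * \<epsilon> - s)"
    by eventually_elim
      (rule weak_derivative_increment_approx[OF H1 mono bound K st(1,2)]; simp add: field_simps)
qed simp

section \<open>A discrete Gronwall inequality with a weakly singular kernel\<close>

lemma powr_backward_increment:
  fixes h x \<kappa> :: real
  assumes "0 < \<kappa>" "\<kappa> \<le> 1" "0 < h" "h \<le> x"
  shows "h * x powr (\<kappa> - 1) \<le> (x powr \<kappa> - (x - h) powr \<kappa>) / \<kappa>"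
proof -
  have "\<exists>l z. x - h < z \<and> z < x \<and> ((\<lambda>y. y powr \<kappa>) has_real_derivative l) (at z) \<and>
      x powr \<kappa> - (x - h) powr \<kappa> = (x - (x - h)) * l"
  proof (rule MVT)
    show "continuous_on {x - h..x} (\<lambda>y. y powr \<kappa>)"
      using assms by (intro continuous_on_powr') (auto intro!: continuous_intros)
    show "(\<lambda>y. y powr \<kappa>) differentiable (at z)" if "x - h < z" "z < x" for z
      using that assms has_real_derivative_powr[of z \<kappa>] real_differentiable_def by fastforce
  qed (use assms in auto)
  then obtain l z where z: "x - h < z" "z < x" and l: "((\<lambda>y. y powr \<kappa>) has_real_derivative l) (at z)"
    and eq: "x powr \<kappa> - (x - h) powr \<kappa> = h * l" by auto
  have "l = \<kappa> * z powr (\<kappa> - 1)"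
    using l has_real_derivative_powr[of z \<kappa>] z assms by (auto intro: DERIV_unique)
  moreover have "x powr (\<kappa> - 1) \<le> z powr (\<kappa> - 1)"
    using z assms by (intro powr_mono2') auto
  ultimately show ?thesis
    using eq assms by (simp add: field_simps)
qed

lemma sum_powr_le:
  fixes h \<kappa> :: real
  assumes "0 < \<kappa>" "\<kappa> \<le> 1" "0 < h"
  shows "(\<Sum>k=1..<Suc i. h * (real k * h) powr (\<kappa> - 1)) \<le> (real i * h) powr \<kappa> / \<kappa>"
proof (induction i)
  case (Suc i)
  have "h * (real (Suc i) * h) powr (\<kappa> - 1) \<le>
      ((real (Suc i) * h) powr \<kappa> - (real i * h) powr \<kappa>) / \<kappa>"
    using powr_backward_increment[of \<kappa> h "real (Suc i) * h"] assms by (simp add: algebra_simps)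
  with Suc show ?case
    by (simp add: diff_divide_distrib)
qed simp

lemma exp_minus_le_powr:
  fixes z s :: real
  assumes "0 < z" "0 \<le> s" "s \<le> 1"
  shows "exp (- z) \<le> z powr (- s)"
proof -
  have "z powr s \<le> 1 + z"
  proof (cases "z \<le> 1")
    case True
    then have "z powr s \<le> 1" using assms by (intro powr_le1) auto
    then show ?thesis using assms by simp
  next
    case False
    then have "z powr s \<le> z powr 1" using assms by (intro powr_mono) auto
    then show ?thesis using assms by simp
  qed
  also have "\<dots> \<le> exp z" by (rule exp_ge_add_one_self)
  finally show ?thesis
    using assms by (simp add: exp_minus powr_minus le_imp_inverse_le)
qed

text \<open>A discrete Beta integral. The two singular factors can be separated, since their product is at most
  the sum of the powers \<open>\<kappa> - 1\<close> of the two distances, whichever of them is the smaller one; each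
  of the resulting sums telescopes.\<close>

lemma singular_kernel_sum_le:
  fixes h p q \<kappa> :: real
  assumes pq: "0 \<le> p" "0 \<le> q" "p + q = 1 - \<kappa>" and \<kappa>: "0 < \<kappa>" and h: "0 < h"
  shows "(\<Sum>k=1..<i. h * (real k * h) powr (- p) * (real (i - k) * h) powr (- q)) \<le>
    2 * (real i * h) powr \<kappa> / \<kappa>"
proof -
  have sum_pq: "- p + - q = \<kappa> - 1"
    using pq by simp
  have prod_le: "x powr (- p) * y powr (- q) \<le> x powr (\<kappa> - 1) + y powr (\<kappa> - 1)"
    if "0 < x" "0 < y" for x y :: real
  proof (cases "x \<le> y")
    case True
    have "x powr (- p) * y powr (- q) \<le> x powr (- p) * x powr (- q)"
      using that True pq by (intro mult_left_mono powr_mono2') auto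
    also have "\<dots> = x powr (\<kappa> - 1)"
      by (simp only: powr_add[symmetric] sum_pq)
    finally show ?thesis by (simp add: add_increasing2)
  next
    case False
    have "x powr (- p) * y powr (- q) \<le> y powr (- p) * y powr (- q)"
      using that False pq by (intro mult_right_mono powr_mono2') auto
    also have "\<dots> = y powr (\<kappa> - 1)"
      by (simp only: powr_add[symmetric] sum_pq)
    finally show ?thesis by (simp add: add_increasing)
  qed
  have "(\<Sum>k=1..<i. h * (real k * h) powr (- p) * (real (i - k) * h) powr (- q)) \<le>
      (\<Sum>k=1..<i. h * (real k * h) powr (\<kappa> - 1) + h * (real (i - k) * h) powr (\<kappa> - 1))"
  proof (rule sum_mono)
    fix k assume "k \<in> {1..<i}"
    then have "0 < real k * h" "0 < real (i - k) * h" using h by auto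
    from prod_le[OF this] h
    show "h * (real k * h) powr (- p) * (real (i - k) * h) powr (- q) \<le>
        h * (real k * h) powr (\<kappa> - 1) + h * (real (i - k) * h) powr (\<kappa> - 1)"
      unfolding mult.assoc distrib_left[symmetric] by (intro mult_left_mono) auto
  qed
  also have "\<dots> = 2 * (\<Sum>k=1..<i. h * (real k * h) powr (\<kappa> - 1))"
  proof -
    have "(\<Sum>k=1..<i. h * (real (i - k) * h) powr (\<kappa> - 1)) =
        (\<Sum>k=1..<i. h * (real k * h) powr (\<kappa> - 1))"
      by (rule sum.reindex_bij_witness[of _ "\<lambda>k. i - k" "\<lambda>k. i - k"]) auto
    then show ?thesis by (simp add: sum.distrib)
  qed
  also have "\<dots> \<le> 2 * ((real i * h) powr \<kappa> / \<kappa>)"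
  proof (intro mult_left_mono)
    show "(\<Sum>k=1..<i. h * (real k * h) powr (\<kappa> - 1)) \<le> (real i * h) powr \<kappa> / \<kappa>"
    proof (cases i)
      case (Suc j)
      have "(\<Sum>k=1..<i. h * (real k * h) powr (\<kappa> - 1)) \<le> (real j * h) powr \<kappa> / \<kappa>"
        unfolding Suc using pq \<kappa> h by (intro sum_powr_le) auto
      also have "\<dots> \<le> (real i * h) powr \<kappa> / \<kappa>"
        using Suc h \<kappa> by (intro divide_right_mono powr_mono2) auto
      finally show ?thesis .
    qed simp
  qed simp
  finally show ?thesis by simp
qed

text \<open>Compare with the exponential \<open>2 A exp (l t)\<close>. Estimating \<open>exp (- l y) \<le> (l y) powr (- s)\<close> makes the
  kernel more singular by the exponent \<open>s\<close>, which stays summable if \<open>s\<close> is half of the room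
  \<open>1 - p - q\<close>, and yields a factor \<open>l powr (- s)\<close>. With \<open>l\<close> large the kernel then maps the exponential
  to at most half of itself, uniformly in the step size, so that the bound reproduces itself.\<close>

lemma discrete_singular_gronwall:
  fixes T C p q :: real
  assumes pq: "0 \<le> p" "0 \<le> q" "p + q < 1" and T: "0 < T" and C: "0 \<le> C"
  shows "\<exists>K>0. \<forall>n\<ge>1. \<forall>A\<ge>0. \<forall>e :: nat \<Rightarrow> real.
    (\<forall>i\<le>n. e i \<le> A + C * (\<Sum>k=1..<i. T / real n * (real k * (T / real n)) powr (- p)
        * (real (i - k) * (T / real n)) powr (- q) * e k)) \<longrightarrow>
    (\<forall>i\<le>n. e i \<le> K * A)"
proof -
  define s where "s = (1 - p - q) / 2"
  have s: "0 < s" "s \<le> 1" "p + (q + s) = 1 - s"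
    using pq by (auto simp: s_def field_simps)
  \<comment> \<open>then \<open>2 C l powr (- s) (2 T powr s / s) \<le> 1\<close>\<close>
  define l where "l = (4 * C * T powr s / s + 1) powr (1 / s)"
  have base: "0 < 4 * C * T powr s / s + 1"
    using C s by (intro add_nonneg_pos) auto
  have l0: "0 < l" using base by (simp add: l_def)
  have ls: "l powr s = 4 * C * T powr s / s + 1"
    using base s by (simp add: l_def powr_powr)
  show ?thesis
  proof (intro exI[of _ "2 * exp (l * T)"] conjI allI impI)
    fix n i :: nat and A :: real and e :: "nat \<Rightarrow> real"
    assume n: "1 \<le> n" and A: "0 \<le> A" and i: "i \<le> n"
    define h where "h = T / real n"
    have h: "0 < h" using n T by (simp add: h_def)
    define w where "w i k = h * (real k * h) powr (- p) * (real (i - k) * h) powr (- q)" for i k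
    assume "\<forall>i\<le>n. e i \<le> A + C * (\<Sum>k=1..<i. T / real n * (real k * (T / real n)) powr (- p)
        * (real (i - k) * (T / real n)) powr (- q) * e k)"
    then have e: "e i \<le> A + C * (\<Sum>k=1..<i. w i k * e k)" if "i \<le> n" for i
      using that by (simp add: w_def h_def)
    have tn: "real i * h \<le> T" if "i \<le> n" for i
      using that n T by (simp add: h_def field_simps)
    have "e i \<le> 2 * A * exp (l * (real i * h))" if "i \<le> n" for i
      using that
    proof (induction i rule: less_induct)
      case (less i)
      have "(\<Sum>k=1..<i. w i k * e k) \<le>
          (\<Sum>k=1..<i. 2 * A * exp (l * (real i * h)) * l powr (- s) *
            (h * (real k * h) powr (- p) * (real (i - k) * h) powr (- (q + s))))"
      proof (rule sum_mono)
        fix k assume k: "k \<in> {1..<i}"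
        let ?y = "real (i - k) * h"
        have y: "0 < ?y" using k h by simp
        have "w i k * e k \<le> w i k * (2 * A * exp (l * (real k * h)))"
          using less k h by (intro mult_left_mono) (auto simp: w_def)
        also have "exp (l * (real k * h)) = exp (l * (real i * h)) * exp (- (l * ?y))"
          using k by (simp add: exp_add[symmetric] of_nat_diff algebra_simps)
        also have "w i k * (2 * A * (exp (l * (real i * h)) * exp (- (l * ?y)))) \<le>
            w i k * (2 * A * (exp (l * (real i * h)) * (l * ?y) powr (- s)))"
          using s h A
          by (intro mult_left_mono exp_minus_le_powr mult_pos_pos[OF l0 y]) (auto simp: w_def)
        also have "\<dots> = 2 * A * exp (l * (real i * h)) * l powr (- s) *
            (h * (real k * h) powr (- p) * ?y powr (- (q + s)))"
        proof -
          have "?y powr (- (q + s)) = ?y powr (- q) * ?y powr (- s)"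
            by (simp add: powr_add[symmetric])
          then show ?thesis
            using l0 y by (simp add: w_def powr_mult)
        qed
        finally show "w i k * e k \<le> 2 * A * exp (l * (real i * h)) * l powr (- s) *
            (h * (real k * h) powr (- p) * ?y powr (- (q + s)))" .
      qed
      also have "\<dots> = 2 * A * exp (l * (real i * h)) * l powr (- s) *
          (\<Sum>k=1..<i. h * (real k * h) powr (- p) * (real (i - k) * h) powr (- (q + s)))"
        by (simp add: sum_distrib_left)
      also have "\<dots> \<le> 2 * A * exp (l * (real i * h)) * l powr (- s) * (2 * T powr s / s)"
      proof (rule mult_left_mono)
        have "(\<Sum>k=1..<i. h * (real k * h) powr (- p) * (real (i - k) * h) powr (- (q + s))) \<le>
            2 * (real i * h) powr s / s"
          using pq s h by (intro singular_kernel_sum_le) auto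
        also have "\<dots> \<le> 2 * T powr s / s"
          using tn[OF less.prems] h s by (intro divide_right_mono mult_left_mono powr_mono2) auto
        finally show "(\<Sum>k=1..<i. h * (real k * h) powr (- p) * (real (i - k) * h) powr (- (q + s))) \<le>
            2 * T powr s / s" .
      qed (use A in auto)
      finally have "C * (\<Sum>k=1..<i. w i k * e k) \<le>
          C * (2 * A * exp (l * (real i * h)) * l powr (- s) * (2 * T powr s / s))"
        using C by (rule mult_left_mono)
      also have "\<dots> = A * exp (l * (real i * h)) * ((4 * C * T powr s / s) / l powr s)"
        by (simp add: powr_minus_divide mult_ac)
      also have "\<dots> \<le> A * exp (l * (real i * h)) * 1"
      proof (rule mult_left_mono)
        have "y / (y + 1) \<le> 1" if "0 < y + 1" for y :: real
          using that by simp
        from this[OF base] show "(4 * C * T powr s / s) / l powr s \<le> 1"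
          unfolding ls .
      qed (use A in simp)
      finally have "e i \<le> A + A * exp (l * (real i * h))"
        using e[OF less.prems] by simp
      moreover have "A \<le> A * exp (l * (real i * h))"
        using A l0 h by (simp add: mult_le_cancel_left1)
      ultimately show ?case by simp
    qed
    from this[OF i] have "e i \<le> 2 * A * exp (l * (real i * h))" .
    also have "\<dots> \<le> 2 * A * exp (l * T)"
      using tn[OF i] l0 A by (intro mult_left_mono) auto
    finally show "e i \<le> 2 * exp (l * T) * A" by (simp add: mult_ac)
  qed simp
qed

section \<open>Absorption in the true system and in the scheme\<close>

text \<open>Having the initial value in the filtration makes absorption by time \<open>t\<close> an event of \<open>F t\<close>, hence
  independent of the later increments of \<open>W\<close>. The function \<open>L\<close> is a solution up to the time \<open>S\<close>.\<close>

locale mv_system = brownian M F W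
  for M :: "'a measure" and F W +
  fixes Y0 :: "'a \<Rightarrow> real" and \<alpha> :: real and S :: ereal and L :: "real \<Rightarrow> real"
  assumes Y0_adapted: "0 \<le> t \<Longrightarrow> Y0 \<in> borel_measurable (F t)"
    and \<alpha>_pos: "0 < \<alpha>" and S_pos: "0 < S"
    and solution: "mv_solution M \<alpha> Y0 W S L"
    and L_0: "L 0 = 0"
    and continuous_L: "continuous_on {t. 0 \<le> t \<and> ereal t < S} L"
begin

definition hit_by :: "real \<Rightarrow> 'a set" where
  "hit_by t = {\<omega> \<in> space M. \<exists>s\<in>{0..t}. mv_process \<alpha> Y0 W L s \<omega> \<le> 0}"

lemma continuous_mv_process:
  assumes "\<omega> \<in> space M" "ereal t < S"
  shows "continuous_on {0..t} (\<lambda>s. mv_process \<alpha> Y0 W L s \<omega>)"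
proof -
  have "{0..t} \<subseteq> {t. 0 \<le> t \<and> ereal t < S}"
    using assms(2) by (auto intro: le_less_trans[of "ereal _" "ereal t"])
  then have [continuous_intros]: "continuous_on {0..t} L"
    by (rule continuous_on_subset[OF continuous_L])
  have [continuous_intros]: "continuous_on {0..t} (\<lambda>s. W s \<omega>)"
    by (rule continuous_on_subset[OF continuous_W[OF assms(1)]]) auto
  show ?thesis
    unfolding mv_process_def by (intro continuous_intros)
qed

text \<open>The hitting time is an infimum over all times, including those where \<open>L\<close> is unspecified. Continuity a
  little beyond \<open>t\<close> excludes that the infimum \<open>t\<close> is only approached from later times.\<close>

lemma hitting_time_le_iff:
  assumes \<omega>: "\<omega> \<in> space M" and t: "0 \<le> t" "ereal t < S"
  shows "hitting_time (mv_process \<alpha> Y0 W L) \<omega> \<le> ereal t \<longleftrightarrow> \<omega> \<in> hit_by t"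
proof
  assume "\<omega> \<in> hit_by t"
  then obtain s where "0 \<le> s" "s \<le> t" "mv_process \<alpha> Y0 W L s \<omega> \<le> 0"
    by (auto simp: hit_by_def)
  then show "hitting_time (mv_process \<alpha> Y0 W L) \<omega> \<le> ereal t"
    unfolding hitting_time_def by (intro Inf_lower2[of "ereal s"]) auto
next
  assume le: "hitting_time (mv_process \<alpha> Y0 W L) \<omega> \<le> ereal t"
  show "\<omega> \<in> hit_by t"
  proof (rule ccontr)
    let ?Y = "\<lambda>s. mv_process \<alpha> Y0 W L s \<omega>"
    assume "\<omega> \<notin> hit_by t"
    then have pos: "0 < ?Y s" if "0 \<le> s" "s \<le> t" for s
      using that \<omega> by (auto simp: hit_by_def not_le)
    \<comment> \<open>room to the right of \<open>t\<close> in which \<open>L\<close> is still continuous\<close>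
    obtain r where r: "t < r" "ereal r < S"
      using ereal_dense2[OF t(2)] by auto
    have "(?Y \<longlongrightarrow> ?Y t) (at t within {0..r})"
      using continuous_mv_process[OF \<omega> r(2)] t r by (auto simp: continuous_on_def)
    from order_tendstoD(1)[OF this pos[OF t(1) order_refl]]
    obtain d where d: "0 < d" "\<And>s. s \<in> {0..r} \<Longrightarrow> s \<noteq> t \<Longrightarrow> dist s t < d \<Longrightarrow> 0 < ?Y s"
      by (auto simp: eventually_at)
    have "ereal (min r (t + d)) \<le> hitting_time (mv_process \<alpha> Y0 W L) \<omega>"
      unfolding hitting_time_def
    proof (rule Inf_greatest)
      fix x assume "x \<in> {ereal s |s. 0 \<le> s \<and> ?Y s \<le> 0}"
      then obtain s where s: "x = ereal s" "0 \<le> s" "?Y s \<le> 0" by auto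
      have "min r (t + d) \<le> s"
      proof (rule ccontr)
        assume "\<not> min r (t + d) \<le> s"
        then have "0 < ?Y s"
          using pos[OF s(2)] d(2)[of s] s(2) by (cases "s \<le> t") (auto simp: dist_real_def)
        with s(3) show False by simp
      qed
      then show "ereal (min r (t + d)) \<le> x" unfolding s(1) by (simp only: ereal_less_eq)
    qed
    also note le
    finally show False using d(1) r(1) by (simp add: min_def split: if_splits)
  qed
qed

text \<open>The process is continuous on \<open>[0,t]\<close>, so it reaches \<open>(-\<infinity>,0]\<close> if and only if it gets below every
  \<open>1 / (n + 1)\<close> at some dyadic point of the interval.\<close>

lemma hit_by_sets_F:
  assumes t: "0 \<le> t" "ereal t < S"
  shows "hit_by t \<in> sets (F t)"
proof -
  let ?Y = "mv_process \<alpha> Y0 W L"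
  define g where "g m j = 0 + real j * (t - 0) / 2 ^ m" for m j :: nat
  have g: "0 \<le> g m j" "j \<le> 2 ^ m \<Longrightarrow> g m j \<le> t" for m j
  proof -
    show "0 \<le> g m j" using t(1) by (simp add: g_def)
    assume "j \<le> 2 ^ m"
    then have "real j \<le> 2 ^ m"
      by (metis of_nat_le_iff of_nat_numeral of_nat_power)
    then have "real j * t \<le> 2 ^ m * t" using t(1) by (rule mult_right_mono)
    then show "g m j \<le> t" by (simp add: g_def field_simps)
  qed
  have "hit_by t = (\<Inter>n. \<Union>m. \<Union>j\<in>{..2 ^ m}. {\<omega> \<in> space (F t). ?Y (g m j) \<omega> < 1 / real (Suc n)})"
  proof (intro equalityI subsetI)
    fix \<omega> assume "\<omega> \<in> hit_by t"
    then obtain s where \<omega>: "\<omega> \<in> space M" and s: "s \<in> {0..t}" "?Y s \<omega> \<le> 0"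
      by (auto simp: hit_by_def)
    obtain j where j: "\<And>m. j m \<le> 2 ^ m" "(\<lambda>m. g m (j m)) \<longlonglongrightarrow> s"
      using dyadic_grid_dense[OF s(1)] unfolding g_def by blast
    have lim: "(\<lambda>m. ?Y (g m (j m)) \<omega>) \<longlonglongrightarrow> ?Y s \<omega>"
      by (rule continuous_on_tendsto_compose[OF continuous_mv_process[OF \<omega> t(2)] j(2)])
        (use s g j(1) in auto)
    have "\<exists>m. \<exists>j\<le>2 ^ m. ?Y (g m j) \<omega> < 1 / real (Suc n)" for n
    proof -
      have "?Y s \<omega> < 1 / real (Suc n)"
        using s(2) by (rule le_less_trans) simp
      from order_tendstoD(2)[OF lim this] show ?thesis
        using j(1) by (auto simp: eventually_sequentially)
    qed
    then show "\<omega> \<in> (\<Inter>n. \<Union>m. \<Union>j\<in>{..2 ^ m}. {\<omega> \<in> space (F t). ?Y (g m j) \<omega> < 1 / real (Suc n)})"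
      using \<omega> space_F[OF t(1)] by (fastforce simp: Bex_def)
  next
    fix \<omega> assume *: "\<omega> \<in> (\<Inter>n. \<Union>m. \<Union>j\<in>{..2 ^ m}. {\<omega> \<in> space (F t). ?Y (g m j) \<omega> < 1 / real (Suc n)})"
    then have \<omega>: "\<omega> \<in> space M" using space_F[OF t(1)] by auto
    obtain s where s: "s \<in> {0..t}" "\<And>r. r \<in> {0..t} \<Longrightarrow> ?Y s \<omega> \<le> ?Y r \<omega>"
      using continuous_attains_inf[OF compact_Icc _ continuous_mv_process[OF \<omega> t(2)]] t(1)
      by auto
    have "?Y s \<omega> \<le> 0"
    proof (rule ccontr)
      assume "\<not> ?Y s \<omega> \<le> 0"
      then obtain n where "inverse (real (Suc n)) < ?Y s \<omega>"
        using reals_Archimedean[of "?Y s \<omega>"] by auto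
      moreover from * obtain m j where "j \<le> 2 ^ m" "?Y (g m j) \<omega> < 1 / real (Suc n)"
        by blast
      ultimately show False
        using s(2)[of "g m j"] g by (auto simp: inverse_eq_divide)
    qed
    then show "\<omega> \<in> hit_by t" using \<omega> s(1) by (auto simp: hit_by_def)
  qed
  also have "\<dots> \<in> sets (F t)"
  proof -
    have [measurable]: "Y0 \<in> borel_measurable (F t)"
      by (rule Y0_adapted[OF t(1)])
    define A where "A n m = (\<Union>j\<in>{..2 ^ m}. {\<omega> \<in> space (F t). ?Y (g m j) \<omega> < 1 / real (Suc n)})"
      for n m :: nat
    have A: "A n m \<in> sets (F t)" for n m
      unfolding A_def
    proof (intro sets.finite_UN)
      fix j assume "j \<in> {..(2::nat) ^ m}"
      then have [measurable]: "W (g m j) \<in> borel_measurable (F t)"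
        using g by (intro measurable_W_F) auto
      show "{\<omega> \<in> space (F t). ?Y (g m j) \<omega> < 1 / real (Suc n)} \<in> sets (F t)"
        unfolding mv_process_def by measurable
    qed simp
    have "(\<Inter>n. \<Union>m. A n m) \<in> sets (F t)"
      using A by (intro sets.countable_INT sets.countable_UN image_subsetI UNIV_not_empty)
    then show ?thesis unfolding A_def .
  qed
  finally show ?thesis .
qed

lemma hit_by_sets: "0 \<le> t \<Longrightarrow> ereal t < S \<Longrightarrow> hit_by t \<in> sets M"
  using hit_by_sets_F sets_F_subset by blast

lemma hit_by_mono: "s \<le> t \<Longrightarrow> hit_by s \<subseteq> hit_by t"
  by (auto simp: hit_by_def)

lemma L_eq_prob_hit_by:
  assumes "0 \<le> t" "ereal t < S"
  shows "L t = prob (hit_by t)"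
proof -
  have "L t = prob {\<omega> \<in> space M. hitting_time (mv_process \<alpha> Y0 W L) \<omega> \<le> ereal t}"
    using solution assms by (auto simp: mv_solution_def)
  also have "{\<omega> \<in> space M. hitting_time (mv_process \<alpha> Y0 W L) \<omega> \<le> ereal t} = hit_by t"
    using hitting_time_le_iff[OF _ assms] by (auto simp: hit_by_def)
  finally show ?thesis .
qed

lemma L_mono:
  assumes "0 \<le> s" "s \<le> t" "ereal t < S"
  shows "L s \<le> L t"
proof -
  have "ereal s < S" using assms by (auto intro: le_less_trans[of _ "ereal t"])
  then show ?thesis
    using assms by (auto simp: L_eq_prob_hit_by intro!: finite_measure_mono hit_by_mono hit_by_sets)
qed

lemma L_bounds: "0 \<le> t \<Longrightarrow> ereal t < S \<Longrightarrow> 0 \<le> L t \<and> L t \<le> 1"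
  by (simp add: L_eq_prob_hit_by)

end

locale mv_scheme = mv_system +
  fixes h :: real and n :: nat and Lt :: "nat \<Rightarrow> real"
  assumes h_pos: "0 < h" and horizon: "ereal (real n * h) < S"
    and scheme: "discrete_loss M \<alpha> Y0 W h n Lt"
begin

abbreviation err :: "nat \<Rightarrow> real" where
  "err i \<equiv> L (real i * h) - Lt i"

lemma mesh:
  assumes "i \<le> n"
  shows "0 \<le> real i * h" "ereal (real i * h) < S"
proof -
  have "real i * h \<le> real n * h" using assms h_pos by (intro mult_right_mono) auto
  then show "ereal (real i * h) < S"
    using horizon by (intro le_less_trans[of "ereal (real i * h)" "ereal (real n * h)"]) auto
qed (use h_pos in simp)

definition absorbed_before :: "nat \<Rightarrow> 'a set" where
  "absorbed_before i = {\<omega> \<in> space M. \<exists>j<i. discrete_process \<alpha> Y0 W h Lt j \<omega> \<le> 0}"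

lemma absorbed_before_sets: "absorbed_before i \<in> sets M"
proof -
  have Y0: "Y0 \<in> borel_measurable M"
    using measurable_from_subalg[OF subalgebra_F Y0_adapted[of 0]] by auto
  have "{\<omega> \<in> space M. discrete_process \<alpha> Y0 W h Lt j \<omega> \<le> 0} \<in> sets M" for j
  proof -
    note [measurable] = Y0
    have [measurable]: "W (real j * h) \<in> borel_measurable M"
      using h_pos by (intro measurable_W) auto
    show ?thesis unfolding discrete_process_def by measurable
  qed
  then have "(\<Union>j\<in>{..<i}. {\<omega> \<in> space M. discrete_process \<alpha> Y0 W h Lt j \<omega> \<le> 0}) \<in> sets M"
    by (intro sets.finite_UN) auto
  also have "(\<Union>j\<in>{..<i}. {\<omega> \<in> space M. discrete_process \<alpha> Y0 W h Lt j \<omega> \<le> 0}) = absorbed_before i"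
    by (auto simp: absorbed_before_def)
  finally show ?thesis .
qed

lemma scheme_eq_prob: "i \<le> n \<Longrightarrow> Lt i = prob (absorbed_before i)"
  using scheme unfolding discrete_loss_explicit[OF h_pos] absorbed_before_def
  by (cases "i = 0") auto

lemma scheme_mono: "i \<le> j \<Longrightarrow> j \<le> n \<Longrightarrow> Lt i \<le> Lt j"
  by (auto simp: scheme_eq_prob absorbed_before_sets intro!: finite_measure_mono)
    (auto simp: absorbed_before_def intro: less_le_trans)

text \<open>The explicit scheme lags behind: if the discrete loss has not exceeded the true one at the earlier
  mesh points, then the discrete process lies above the true one there, and a particle absorbed by the
  scheme has been absorbed by the true system. This makes the error one-sided.\<close>

lemma scheme_le_loss: "i \<le> n \<Longrightarrow> Lt i \<le> L (real i * h)"
proof (induction i rule: less_induct)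
  case (less i)
  have "AE \<omega> in M. W 0 \<omega> = 0"
    using brownian by (simp add: brownian_motion_def)
  then have "AE \<omega> in M. \<omega> \<in> absorbed_before i \<longrightarrow> \<omega> \<in> hit_by (real i * h)"
  proof eventually_elim
    case (elim \<omega>)
    show ?case
    proof
      assume "\<omega> \<in> absorbed_before i"
      then obtain j where \<omega>: "\<omega> \<in> space M" and j: "j < i" "discrete_process \<alpha> Y0 W h Lt j \<omega> \<le> 0"
        by (auto simp: absorbed_before_def)
      have "\<alpha> * Lt j \<le> \<alpha> * L (real j * h)"
        using less j \<alpha>_pos by (intro mult_left_mono) auto
      then have "mv_process \<alpha> Y0 W L (real j * h) \<omega> \<le> 0"
        using j(2) elim L_0 by (auto simp: mv_process_def discrete_process_def split: if_splits)
      then show "\<omega> \<in> hit_by (real i * h)"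
        using \<omega> j(1) h_pos by (auto simp: hit_by_def intro!: bexI[of _ "real j * h"])
    qed
  qed
  then show ?case
    unfolding scheme_eq_prob[OF less.prems] L_eq_prob_hit_by[OF mesh[OF less.prems]]
    by (intro finite_measure_mono_AE hit_by_sets mesh less.prems)
qed

definition first_hit_in :: "nat \<Rightarrow> 'a set" where
  "first_hit_in k = hit_by (real k * h) - hit_by (real (k - 1) * h)"

lemma first_hit_in_sets_F: "k \<le> n \<Longrightarrow> first_hit_in k \<in> sets (F (real k * h))"
  unfolding first_hit_in_def
  using hit_by_sets_F[OF mesh[of k]] hit_by_sets_F[OF mesh[of "k - 1"]]
    sets_F_mono[of "real (k - 1) * h" "real k * h"] h_pos
  by (intro sets.Diff) (auto intro: mult_right_mono)

lemma first_hit_in_sets: "k \<le> n \<Longrightarrow> first_hit_in k \<in> sets M"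
  using first_hit_in_sets_F sets_F_subset[OF mesh(1)] by blast

lemma prob_first_hit_in:
  assumes "k \<le> n"
  shows "prob (first_hit_in k) = L (real k * h) - L (real (k - 1) * h)"
proof -
  have "k - 1 \<le> n" using assms by simp
  then show ?thesis
    unfolding first_hit_in_def L_eq_prob_hit_by[OF mesh[OF assms]]
      L_eq_prob_hit_by[OF mesh[OF \<open>k - 1 \<le> n\<close>]]
    using assms h_pos
    by (intro finite_measure_Diff hit_by_sets mesh hit_by_mono mult_right_mono) auto
qed

lemma disjoint_first_hit_in: "disjoint_family first_hit_in"
proof -
  have "first_hit_in j \<inter> first_hit_in k = {}" if "j < k" for j k
  proof -
    have "real j * h \<le> real (k - 1) * h"
      using that h_pos by (intro mult_right_mono) auto
    from hit_by_mono[OF this] show ?thesis by (auto simp: first_hit_in_def)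
  qed
  then show ?thesis
    unfolding disjoint_family_on_def by (metis Int_commute linorder_neqE_nat)
qed

lemma hit_by_eq_Union_first_hit_in:
  "hit_by (real i * h) = hit_by 0 \<union> (\<Union>k\<in>{1..i}. first_hit_in k)"
proof (induction i)
  case (Suc i)
  have "hit_by (real (Suc i) * h) = hit_by (real i * h) \<union> first_hit_in (Suc i)"
    using hit_by_mono[of "real i * h" "real (Suc i) * h"] h_pos by (auto simp: first_hit_in_def)
  then show ?case
    unfolding Suc by (simp add: atLeastAtMostSuc_conv Un_ac)
qed simp

text \<open>The central estimate. A particle of the true system that is absorbed at a time \<open>s\<close> of the \<open>k\<close>-th mesh
  interval, and not by the scheme, must from then on keep \<open>W\<close> above the barrier of the scheme. The
  discrete loss increases, so at later mesh points that barrier is not lower than at \<open>t\<^sub>k\<close>, and the path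
  cannot descend by more than \<open>\<alpha> (L (t\<^sub>k) - Lt k) + \<eta>\<close> below its value at \<open>t\<^sub>k\<close>. By reflection a
  Brownian path does so for \<open>m\<close> steps with a probability of the order of this distance divided by the
  square root of the elapsed time. Only the error at \<open>t\<^sub>k\<close> itself enters, which keeps the recursion
  closed.\<close>

lemma survival_after_hit:
  assumes k: "1 \<le> k" "k + m < i" "i \<le> n" and m: "0 < m"
    and \<eta>: "0 < \<eta>" and Bd: "Bd \<in> sets M"
    and osc: "\<And>\<omega> k u. \<omega> \<in> space M \<Longrightarrow> \<omega> \<notin> Bd \<Longrightarrow> k \<in> {1..n} \<Longrightarrow>
      u \<in> {real (k - 1) * h..real k * h} \<Longrightarrow> \<bar>W u \<omega> - W (real (k - 1) * h) \<omega>\<bar> \<le> \<eta> / 2"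
  shows "prob (first_hit_in k - absorbed_before i - Bd) \<le>
    prob (first_hit_in k) * ((2 * \<alpha> * err k + 4 * \<eta>) / (sqrt (real m * h) * sqrt (2 * pi)))
    + prob (first_hit_in k \<inter> Bd)"
proof -
  define a where "a = \<alpha> * err k + \<eta>"
  have a: "0 < a"
    using scheme_le_loss[of k] k \<alpha>_pos \<eta> by (simp add: a_def add_nonneg_pos)
  define u where "u j = real (k + j) * h" for j
  have u: "0 \<le> u 0" "mono u" "u 0 = real k * h" "0 \<le> u j" for j
    using h_pos by (auto simp: u_def intro!: monoI mult_right_mono)
  interpret symmetric_walk M "\<lambda>j. F (u j)" "\<lambda>j \<omega>. - 1 * (W (u j) \<omega> - W (u 0) \<omega>)" m
    by (rule symmetric_walk_brownian[OF u(1,2)]) simp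
  let ?A = "first_hit_in k"
  have A: "?A \<in> sets (F (u 0))"
    using first_hit_in_sets_F[of k] k by (simp add: u(3))
  have A_M: "?A \<in> sets M"
    using k by (intro first_hit_in_sets) auto
  \<comment> \<open>the barrier argument, at the mesh points \<open>k, \<dots>, k + m\<close>\<close>
  have "?A - absorbed_before i - Bd \<subseteq>
      ?A \<inter> {\<omega> \<in> space M. \<forall>j\<le>m. - 1 * (W (u j) \<omega> - W (u 0) \<omega>) < a}"
  proof (intro subsetI)
    fix \<omega> assume *: "\<omega> \<in> ?A - absorbed_before i - Bd"
    then have \<omega>: "\<omega> \<in> space M" "\<omega> \<notin> Bd" by (auto simp: first_hit_in_def hit_by_def)
    from * obtain s where s: "0 \<le> s" "s \<le> real k * h" "mv_process \<alpha> Y0 W L s \<omega> \<le> 0"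
      by (auto simp: first_hit_in_def hit_by_def)
    have s1: "real (k - 1) * h < s"
    proof (rule ccontr)
      assume "\<not> real (k - 1) * h < s"
      with s \<omega> have "\<omega> \<in> hit_by (real (k - 1) * h)" by (auto simp: hit_by_def)
      with * show False by (simp add: first_hit_in_def)
    qed
    have "- 1 * (W (u j) \<omega> - W (u 0) \<omega>) < a" if j: "j \<le> m" for j
    proof -
      have q: "k + j < i" "k + j \<noteq> 0" "k \<le> k + j" "k + j \<le> n" using j k by auto
      have "0 < discrete_process \<alpha> Y0 W h Lt (k + j) \<omega>"
        using * \<omega>(1) q(1) by (auto simp: absorbed_before_def not_le)
      then have "\<alpha> * Lt (k + j) < Y0 \<omega> + W (u j) \<omega>"
        using q(2) by (auto simp: discrete_process_def u_def simp del: of_nat_add split: if_splits)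
      moreover have "\<alpha> * Lt k \<le> \<alpha> * Lt (k + j)"
        using scheme_mono[OF q(3,4)] \<alpha>_pos by simp
      moreover have "Y0 \<omega> + W s \<omega> \<le> \<alpha> * L s"
        using s(3) by (simp add: mv_process_def)
      moreover have "\<alpha> * L s \<le> \<alpha> * L (real k * h)"
        using L_mono[OF s(1,2) mesh(2)[of k]] k \<alpha>_pos by simp
      moreover have "W (u 0) \<omega> - W s \<omega> \<le> \<eta>"
      proof -
        have "\<bar>W s \<omega> - W (real (k - 1) * h) \<omega>\<bar> \<le> \<eta> / 2"
          using k s s1 by (intro osc \<omega>) auto
        moreover have "\<bar>W (real k * h) \<omega> - W (real (k - 1) * h) \<omega>\<bar> \<le> \<eta> / 2"
          using k h_pos by (intro osc \<omega>) (auto intro: mult_right_mono)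
        ultimately show ?thesis unfolding u(3) abs_le_iff by linarith
      qed
      ultimately show ?thesis
        by (simp add: a_def right_diff_distrib)
    qed
    with * \<omega>(1) show "\<omega> \<in> ?A \<inter> {\<omega> \<in> space M. \<forall>j\<le>m. - 1 * (W (u j) \<omega> - W (u 0) \<omega>) < a}"
      by blast
  qed
  then have "prob (?A - absorbed_before i - Bd) \<le>
      prob (?A \<inter> {\<omega> \<in> space M. \<forall>j\<le>m. - 1 * (W (u j) \<omega> - W (u 0) \<omega>) < a})"
  proof (rule finite_measure_mono)
    have "{\<omega> \<in> space M. \<forall>j\<in>{..m}. - 1 * (W (u j) \<omega> - W (u 0) \<omega>) < a} \<in> sets M"
    proof (intro sets.sets_Collect_finite_All)
      fix j assume "j \<in> {..m}"
      have [measurable]: "W (u j) \<in> borel_measurable M" "W (u 0) \<in> borel_measurable M"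
        by (intro measurable_W u(4))+
      show "{\<omega> \<in> space M. - 1 * (W (u j) \<omega> - W (u 0) \<omega>) < a} \<in> sets M" by measurable
    qed simp
    then show "?A \<inter> {\<omega> \<in> space M. \<forall>j\<le>m. - 1 * (W (u j) \<omega> - W (u 0) \<omega>) < a} \<in> sets M"
      unfolding Ball_def atMost_iff by (intro sets.Int A_M)
  qed
  also have "\<dots> \<le>
      prob (?A \<inter> {\<omega> \<in> space M. - 1 * (W (u m) \<omega> - W (u 0) \<omega>) < a})
      - prob (?A \<inter> {\<omega> \<in> space M. a + 2 * \<eta> < - 1 * (W (u m) \<omega> - W (u 0) \<omega>)})
      + prob (?A \<inter> Bd)"
  proof (rule reflection_with_overshoot[OF A _ Bd])
    fix \<omega> j
    assume \<omega>: "\<omega> \<in> space M" "\<omega> \<notin> Bd" and j: "j \<le> m"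
      and below: "\<And>i. i < j \<Longrightarrow> - 1 * (W (u i) \<omega> - W (u 0) \<omega>) < a"
    show "- 1 * (W (u j) \<omega> - W (u 0) \<omega>) \<le> a + \<eta>"
    proof (cases j)
      case 0
      then show ?thesis using a \<eta> by simp
    next
      case (Suc l)
      have "\<bar>W (real (k + j) * h) \<omega> - W (real (k + j - 1) * h) \<omega>\<bar> \<le> \<eta> / 2"
        using k j h_pos by (intro osc \<omega>) (auto intro: mult_right_mono)
      then have "\<bar>W (u j) \<omega> - W (u l) \<omega>\<bar> \<le> \<eta> / 2"
        by (simp add: u_def Suc)
      then have "W (u l) \<omega> - W (u j) \<omega> \<le> \<eta> / 2"
        unfolding abs_le_iff by linarith
      moreover have "W (u 0) \<omega> - W (u l) \<omega> < a"
        using below[of l] Suc by simp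
      ultimately have "W (u 0) \<omega> - W (u j) \<omega> \<le> a + \<eta>"
        using \<eta> by linarith
      then show ?thesis by simp
    qed
  qed (use \<eta> in simp)
  \<comment> \<open>the difference of the two tails is the mass of a window of width \<open>2 a + 2 \<eta>\<close>\<close>
  also have "prob (?A \<inter> {\<omega> \<in> space M. - 1 * (W (u m) \<omega> - W (u 0) \<omega>) < a})
      - prob (?A \<inter> {\<omega> \<in> space M. a + 2 * \<eta> < - 1 * (W (u m) \<omega> - W (u 0) \<omega>)}) \<le>
    prob ?A * ((2 * \<alpha> * err k + 4 * \<eta>) / (sqrt (real m * h) * sqrt (2 * pi)))"
  proof -
    let ?X = "\<lambda>\<omega>. W (u m) \<omega> - W (u 0) \<omega>"
    have lt: "u 0 < u m" using m h_pos by (simp add: u_def)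
    have um: "u m - u 0 = real m * h" by (simp add: u_def algebra_simps)
    note X = distributed_increment[OF u(1) lt, unfolded um]
    have [measurable]: "?X \<in> borel_measurable M"
      using distributed_measurable[OF X] by simp
    have e1: "- 1 * x < a \<longleftrightarrow> - a < x" and e2: "a + 2 * \<eta> < - 1 * x \<longleftrightarrow> x < - (a + 2 * \<eta>)"
      for x :: real by auto
    have 1: "prob (?A \<inter> {\<omega> \<in> space M. - 1 * ?X \<omega> < a}) = prob ?A * prob {\<omega> \<in> space M. - a < ?X \<omega>}"
      using prob_increment[OF u(1) lt A greaterThan_borel, of "- a"]
      by (simp only: e1 greaterThan_iff)
    have 2: "prob (?A \<inter> {\<omega> \<in> space M. a + 2 * \<eta> < - 1 * ?X \<omega>}) =
        prob ?A * prob {\<omega> \<in> space M. ?X \<omega> < - (a + 2 * \<eta>)}"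
      using prob_increment[OF u(1) lt A lessThan_borel, of "- (a + 2 * \<eta>)"]
      by (simp only: e2 lessThan_iff)
    have "prob {\<omega> \<in> space M. - a < ?X \<omega>} = prob {\<omega> \<in> space M. ?X \<omega> < a}"
      using prob_normal_symmetric[OF X, of "- a"] by simp
    moreover have "prob {\<omega> \<in> space M. ?X \<omega> < a} \<le>
        prob {\<omega> \<in> space M. - (a + 2 * \<eta>) \<le> ?X \<omega> \<and> ?X \<omega> < a} +
        prob {\<omega> \<in> space M. ?X \<omega> < - (a + 2 * \<eta>)}"
    proof (rule order_trans[OF finite_measure_mono measure_Un_le])
      show "{\<omega> \<in> space M. ?X \<omega> < a} \<subseteq>
          {\<omega> \<in> space M. - (a + 2 * \<eta>) \<le> ?X \<omega> \<and> ?X \<omega> < a} \<union> {\<omega> \<in> space M. ?X \<omega> < - (a + 2 * \<eta>)}"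
        using not_le by blast
    qed measurable
    moreover have "prob {\<omega> \<in> space M. - (a + 2 * \<eta>) \<le> ?X \<omega> \<and> ?X \<omega> < a} \<le>
        (2 * \<alpha> * err k + 4 * \<eta>) / (sqrt (real m * h) * sqrt (2 * pi))"
    proof -
      have width: "a - (- (a + 2 * \<eta>)) = 2 * \<alpha> * err k + 4 * \<eta>"
        by (simp add: a_def algebra_simps)
      show ?thesis
        unfolding width[symmetric] using a \<eta> m h_pos by (intro prob_normal_interval[OF X]) auto
    qed
    ultimately have "prob {\<omega> \<in> space M. - a < ?X \<omega>} - prob {\<omega> \<in> space M. ?X \<omega> < - (a + 2 * \<eta>)} \<le>
        (2 * \<alpha> * err k + 4 * \<eta>) / (sqrt (real m * h) * sqrt (2 * pi))"
      by linarith
    then show ?thesis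
      unfolding 1 2 right_diff_distrib[symmetric] by (intro mult_left_mono) auto
  qed
  finally show ?thesis by simp
qed

text \<open>Sum the survival estimate over the mesh interval of the true absorption. In the last two intervals
  the scheme has had no step to catch up, and the whole increment of the loss is counted.\<close>

lemma error_recursion:
  assumes i: "1 \<le> i" "i \<le> n"
    and \<eta>: "0 < \<eta>" and Bd: "Bd \<in> sets M"
    and osc: "\<And>\<omega> k u. \<omega> \<in> space M \<Longrightarrow> \<omega> \<notin> Bd \<Longrightarrow> k \<in> {1..n} \<Longrightarrow>
      u \<in> {real (k - 1) * h..real k * h} \<Longrightarrow> \<bar>W u \<omega> - W (real (k - 1) * h) \<omega>\<bar> \<le> \<eta> / 2"
  shows "err i \<le> 2 * prob Bd + prob (first_hit_in i) + prob (first_hit_in (i - 1)) +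
    (\<Sum>k=1..<i - 1. prob (first_hit_in k) *
      ((2 * \<alpha> * err k + 4 * \<eta>) / (sqrt (real (i - 1 - k) * h) * sqrt (2 * pi))))"
proof -
  let ?A = first_hit_in and ?D = "absorbed_before i"
  let ?q = "\<lambda>k. prob (?A k) * ((2 * \<alpha> * err k + 4 * \<eta>) / (sqrt (real (i - 1 - k) * h) * sqrt (2 * pi)))"
  have A: "?A k \<in> sets M" if "k \<in> {1..i}" for k
    using that i by (intro first_hit_in_sets) auto
  have H: "hit_by (real i * h) \<in> sets M" "hit_by 0 \<in> sets M"
    using i mesh S_pos by (auto intro!: hit_by_sets simp: zero_ereal_def)
  note D = absorbed_before_sets[of i]
  have "err i = prob (hit_by (real i * h)) - prob ?D"
    using i by (simp add: scheme_eq_prob L_eq_prob_hit_by mesh)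
  also have "\<dots> \<le> prob (hit_by (real i * h) - ?D)"
    using measure_Un_le[of "hit_by (real i * h) - ?D" M ?D]
      finite_measure_mono[of "hit_by (real i * h)" "(hit_by (real i * h) - ?D) \<union> ?D"] H D by auto
  also have "\<dots> \<le> prob (hit_by 0 \<union> (Bd \<union> (\<Union>k\<in>{1..i}. ?A k - ?D - Bd)))"
    unfolding hit_by_eq_Union_first_hit_in using A H D Bd
    by (intro finite_measure_mono sets.Un sets.finite_UN sets.Diff) auto
  also have "\<dots> \<le> prob (hit_by 0) + (prob Bd + (\<Sum>k\<in>{1..i}. prob (?A k - ?D - Bd)))"
    using A H D Bd
    by (intro order_trans[OF measure_Un_le] add_mono order_refl finite_measure_subadditive_finite
        sets.Un sets.finite_UN sets.Diff) auto
  also have "prob (hit_by 0) = 0"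
    using L_eq_prob_hit_by[of 0] S_pos L_0 by (simp add: zero_ereal_def)
  also have "(\<Sum>k\<in>{1..i}. prob (?A k - ?D - Bd)) \<le>
      prob (?A i) + prob (?A (i - 1)) + (\<Sum>k=1..<i - 1. prob (?A k - ?D - Bd))"
  proof -
    have le: "prob (?A k - ?D - Bd) \<le> prob (?A k)" if "k \<le> n" for k
      using that by (intro finite_measure_mono first_hit_in_sets) auto
    show ?thesis
    proof (cases "i = 1")
      case True
      then show ?thesis using le[of 1] i by (simp add: add_increasing2)
    next
      case False
      then have "{1..i} = insert i (insert (i - 1) {1..<i - 1})" using i by auto
      moreover have "i \<notin> insert (i - 1) {1..<i - 1}" "i - 1 \<notin> {1..<i - 1}" using i by auto
      ultimately have "(\<Sum>k\<in>{1..i}. prob (?A k - ?D - Bd)) =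
          prob (?A i - ?D - Bd) + (prob (?A (i - 1) - ?D - Bd) + (\<Sum>k=1..<i - 1. prob (?A k - ?D - Bd)))"
        by (simp del: One_nat_def)
      moreover have "i - 1 \<le> n" using i by simp
      ultimately show ?thesis using le[OF i(2)] le[of "i - 1"] by linarith
    qed
  qed
  also have "(\<Sum>k=1..<i - 1. prob (?A k - ?D - Bd)) \<le> (\<Sum>k=1..<i - 1. ?q k + prob (?A k \<inter> Bd))"
    using i by (intro sum_mono survival_after_hit[OF _ _ _ _ \<eta> Bd osc]) auto
  also have "\<dots> = (\<Sum>k=1..<i - 1. ?q k) + (\<Sum>k=1..<i - 1. prob (?A k \<inter> Bd))"
    by (rule sum.distrib)
  also have "(\<Sum>k=1..<i - 1. prob (?A k \<inter> Bd)) = prob (\<Union>k\<in>{1..<i - 1}. ?A k \<inter> Bd)"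
    using A Bd disjoint_first_hit_in
    by (intro finite_measure_finite_Union[symmetric]) (auto simp: disjoint_family_on_def)
  also have "\<dots> \<le> prob Bd"
    using Bd by (intro finite_measure_mono) auto
  finally show ?thesis by simp
qed

text \<open>A single exceptional event for all mesh intervals. Since the events of first absorption are disjoint,
  its probability enters the error only as a whole and is not summed over the intervals again.\<close>

lemma oscillation_event:
  assumes \<eta>: "0 < \<eta>"
  obtains Bd where "Bd \<in> sets M"
    and "\<And>\<omega> k u. \<omega> \<in> space M \<Longrightarrow> \<omega> \<notin> Bd \<Longrightarrow> k \<in> {1..n} \<Longrightarrow>
      u \<in> {real (k - 1) * h..real k * h} \<Longrightarrow> \<bar>W u \<omega> - W (real (k - 1) * h) \<omega>\<bar> \<le> \<eta> / 2"
    and "prob Bd \<le> real n * (4 * (fact (2 * p) / (2 ^ p * fact p) * (sqrt h / (\<eta> / 2)) ^ (2 * p)))"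
proof -
  define E where "E k = {\<omega> \<in> space M. \<exists>u\<in>{real (k - 1) * h..real k * h}.
    \<eta> / 2 < \<bar>W u \<omega> - W (real (k - 1) * h) \<omega>\<bar>}" for k
  let ?t = "4 * (fact (2 * p) / (2 ^ p * fact p) * (sqrt h / (\<eta> / 2)) ^ (2 * p))"
  have E: "E k \<in> sets M" "prob (E k) \<le> ?t" if "k \<in> {1..n}" for k
  proof -
    have k: "0 \<le> real (k - 1) * h" "real (k - 1) * h < real k * h" "0 < \<eta> / 2"
      using that h_pos \<eta> by auto
    have "real k * h - real (k - 1) * h = h"
      using that by (simp add: of_nat_diff algebra_simps)
    then show "E k \<in> sets M" "prob (E k) \<le> ?t"
      unfolding E_def using prob_oscillation_le[OF k] by auto
  qed
  show ?thesis
  proof (rule that)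
    show "(\<Union>k\<in>{1..n}. E k) \<in> sets M"
      using E by (intro sets.finite_UN) auto
    have "prob (\<Union>k\<in>{1..n}. E k) \<le> (\<Sum>k\<in>{1..n}. prob (E k))"
      using E by (intro finite_measure_subadditive_finite) auto
    also have "\<dots> \<le> real (card {1..n}) * ?t"
      using E by (intro sum_bounded_above) auto
    finally show "prob (\<Union>k\<in>{1..n}. E k) \<le> real n * ?t" by simp
  qed (auto simp: E_def not_less)
qed

end

section \<open>The rate of convergence\<close>

lemma powr_le_scaled:
  fixes h T a b :: real
  assumes "0 < h" "h \<le> T" "b \<le> a"
  shows "h powr a \<le> T powr (a - b) * h powr b"
proof -
  have "h powr a = h powr (a - b) * h powr b"
    by (simp add: powr_add[symmetric])
  also have "\<dots> \<le> T powr (a - b) * h powr b"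
    using assms by (intro mult_right_mono powr_mono2) auto
  finally show ?thesis .
qed

context mv_system
begin

text \<open>On the first interval this is the growth bound on \<open>L\<close>; on the others it follows from the bound on the
  weak derivative, where \<open>t\<^sub>k\<^sub>-\<^sub>1 \<ge> t\<^sub>k / 2\<close> allows the singular weight to be taken at \<open>t\<^sub>k\<close>.\<close>

lemma loss_increment_on_mesh:
  assumes H1: "\<And>t. 0 < t \<Longrightarrow> ereal t < S \<Longrightarrow> H1_weak_deriv 0 t L L'"
    and L': "AE t in lborel. 0 < t \<longrightarrow> ereal t < S \<longrightarrow> L' t \<le> B' * t powr (- \<gamma>)"
    and L: "\<And>t. 0 \<le> t \<Longrightarrow> ereal t < S \<Longrightarrow> L t \<le> B * t powr (1 - \<gamma>)"
    and \<gamma>: "0 \<le> \<gamma>" "\<gamma> \<le> 1" and h: "0 < h" and k: "1 \<le> k" "ereal (real k * h) < S"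
  shows "L (real k * h) - L (real (k - 1) * h) \<le> (\<bar>B\<bar> + 2 * \<bar>B'\<bar>) * (h * (real k * h) powr (- \<gamma>))"
proof (cases "k = 1")
  case True
  have "L h \<le> B * h powr (1 - \<gamma>)"
    using L[of h] k h True by simp
  also have "h powr (1 - \<gamma>) = h * h powr (- \<gamma>)"
    using h by (simp add: powr_diff powr_minus_divide)
  also have "B * (h * h powr (- \<gamma>)) \<le> (\<bar>B\<bar> + 2 * \<bar>B'\<bar>) * (h * h powr (- \<gamma>))"
    using h by (intro mult_right_mono) auto
  finally show ?thesis using True by (simp add: L_0)
next
  case False
  then have k2: "2 \<le> k" using k by simp
  obtain b where b: "real k * h < b" "ereal b < S"
    using ereal_dense2[OF k(2)] by auto
  let ?s = "real (k - 1) * h" and ?t = "real k * h"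
  have s: "0 < ?s" "?s \<le> ?t" using k2 h by auto
  have bS: "ereal x < S" if "x \<le> b" for x
    using that b(2) by (auto intro: le_less_trans[of "ereal x" "ereal b"])
  have "L ?t - L ?s \<le> \<bar>B'\<bar> * ?s powr (- \<gamma>) * (?t - ?s)"
  proof (rule weak_derivative_increment_le[where b = b and C = 1])
    show "H1_weak_deriv 0 b L L'"
      using s b(1) by (intro H1 b(2)) linarith
    show "L x \<le> L y" if "0 < x" "x \<le> y" "y < b" for x y
      using that bS by (intro L_mono) auto
    show "\<bar>L x\<bar> \<le> 1" if "0 < x" "x < b" for x
      using that bS L_bounds[of x] by auto
    show "continuous_on {0<..<b} L"
      by (rule continuous_on_subset[OF continuous_L]) (use bS in auto)
    show "AE x in lborel. ?s \<le> x \<longrightarrow> x < b \<longrightarrow> L' x \<le> \<bar>B'\<bar> * ?s powr (- \<gamma>)"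
      using L'
    proof eventually_elim
      case (elim x)
      show ?case
      proof (intro impI)
        assume x: "?s \<le> x" "x < b"
        then have "0 < x" using s(1) by linarith
        then have "L' x \<le> B' * x powr (- \<gamma>)"
          using elim bS x by simp
        also have "\<dots> \<le> \<bar>B'\<bar> * x powr (- \<gamma>)"
          by (intro mult_right_mono) auto
        also have "\<dots> \<le> \<bar>B'\<bar> * ?s powr (- \<gamma>)"
          using \<gamma>(1) by (intro mult_left_mono powr_mono2' s(1) x(1)) auto
        finally show "L' x \<le> \<bar>B'\<bar> * ?s powr (- \<gamma>)" .
      qed
    qed
  qed (rule s b(1) | simp)+
  also have "?t - ?s = h"
    using k2 by (simp add: of_nat_diff algebra_simps)
  also have "\<bar>B'\<bar> * ?s powr (- \<gamma>) * h \<le> \<bar>B'\<bar> * (2 * ?t powr (- \<gamma>)) * h"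
  proof (intro mult_right_mono mult_left_mono)
    have "real k / 2 \<le> real (k - 1)" using k2 by (simp add: of_nat_diff)
    from mult_right_mono[OF this, of h] h have "?t / 2 \<le> ?s" by simp
    then have "?s powr (- \<gamma>) \<le> (?t / 2) powr (- \<gamma>)"
      using k2 h \<gamma> by (intro powr_mono2') auto
    also have "\<dots> = 2 powr \<gamma> * ?t powr (- \<gamma>)"
      using h by (simp add: powr_divide powr_minus_divide)
    also have "\<dots> \<le> 2 powr 1 * ?t powr (- \<gamma>)"
      using \<gamma> by (intro mult_right_mono powr_mono) auto
    finally show "?s powr (- \<gamma>) \<le> 2 * ?t powr (- \<gamma>)" by simp
  qed (use h in auto)
  also have "\<dots> \<le> (\<bar>B\<bar> + 2 * \<bar>B'\<bar>) * (h * ?t powr (- \<gamma>))"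
    using h by (simp add: algebra_simps)
  finally show ?thesis .
qed

text \<open>With \<open>\<eta> = h powr (1/2 - \<delta>)\<close> an oscillation of size \<open>\<eta>\<close> within one mesh interval is
  \<open>h powr (- \<delta>)\<close> standard deviations, so its probability, even summed over all intervals, is smaller
  than any power of \<open>h\<close>. The error recursion is then a discrete Volterra inequality with the kernel
  \<open>t\<^sub>k powr (- \<gamma>) (t\<^sub>i - t\<^sub>k) powr (- 1/2)\<close> and an inhomogeneity of order \<open>\<eta>\<close>.\<close>

lemma scheme_error_rate:
  assumes increment: "\<And>h k. 0 < h \<Longrightarrow> 1 \<le> k \<Longrightarrow> real k * h \<le> T \<Longrightarrow>
      L (real k * h) - L (real (k - 1) * h) \<le> K * (h * (real k * h) powr (- \<gamma>))"
    and K: "0 \<le> K" and \<gamma>: "0 \<le> \<gamma>" "\<gamma> < 1 / 2"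
    and T: "0 < T" "ereal T < S" and \<delta>: "0 < \<delta>"
  shows "\<exists>C>0. \<forall>n\<ge>1. \<forall>Lt. discrete_loss M \<alpha> Y0 W (T / real n) n Lt \<longrightarrow>
    (\<forall>i\<le>n. \<bar>Lt i - L (real i * (T / real n))\<bar> \<le> C * (T / real n) powr (1 / 2 - \<delta>))"
proof -
  define \<kappa> where "\<kappa> = 1 / 2 - \<gamma>"
  have \<kappa>: "0 < \<kappa>" "\<gamma> + 1 / 2 = 1 - \<kappa>" using \<gamma> by (auto simp: \<kappa>_def)
  obtain G where G: "0 < G" and gronwall: "\<And>n A (e :: nat \<Rightarrow> real) i. 1 \<le> n \<Longrightarrow> 0 \<le> A \<Longrightarrow>
    (\<And>i. i \<le> n \<Longrightarrow> e i \<le> A + 2 * \<alpha> * K * (\<Sum>k=1..<i. T / real n * (real k * (T / real n)) powr (- \<gamma>)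
        * (real (i - k) * (T / real n)) powr (- (1 / 2)) * e k)) \<Longrightarrow> i \<le> n \<Longrightarrow> e i \<le> G * A"
    using discrete_singular_gronwall[of \<gamma> "1 / 2" T "2 * \<alpha> * K"] \<gamma> K T \<alpha>_pos by force
  \<comment> \<open>an order of moments with \<open>n h powr (2 p \<delta>)\<close> at most of the order of \<open>h powr (1/2)\<close>\<close>
  obtain p :: nat where "3 / (4 * \<delta>) \<le> real p"
    using real_arch_simple by blast
  then have p: "3 / 2 \<le> \<delta> * real (2 * p)"
    using \<delta> by (simp add: field_simps)
  define c where "c = 4 * (fact (2 * p) / (2 ^ p * fact p) * (2::real) ^ (2 * p)) * T
    * T powr (\<delta> * real (2 * p) - 1 - (1 / 2 - \<delta>))"
  define C where "C = 2 * c + 2 * K * T powr (1 - \<gamma> - (1 / 2 - \<delta>)) + 4 * K * (2 * T powr \<kappa> / \<kappa>)"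
  have c0: "0 \<le> c" using T by (simp add: c_def)
  have C0: "0 \<le> C" using c0 K \<kappa> by (simp add: C_def)
  show ?thesis
  proof (intro exI[of _ "G * C + 1"] conjI allI impI)
    show "0 < G * C + 1" using G C0 by (simp add: add_nonneg_pos)
    fix n i :: nat and Lt assume n: "1 \<le> n" and Lt: "discrete_loss M \<alpha> Y0 W (T / real n) n Lt"
      and i: "i \<le> n"
    define h where "h = T / real n"
    have h: "0 < h" "h \<le> T" "real n * h = T"
      using n T by (auto simp: h_def field_simps)
    interpret mv_scheme M F W Y0 \<alpha> S L h n Lt
      by unfold_locales (use h T Lt in \<open>auto simp: h_def\<close>)
    define \<eta> where "\<eta> = h powr (1 / 2 - \<delta>)"
    have \<eta>: "0 < \<eta>" using h by (simp add: \<eta>_def)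
    obtain Bd where Bd: "Bd \<in> sets M"
      and osc: "\<And>\<omega> k u. \<omega> \<in> space M \<Longrightarrow> \<omega> \<notin> Bd \<Longrightarrow> k \<in> {1..n} \<Longrightarrow>
        u \<in> {real (k - 1) * h..real k * h} \<Longrightarrow> \<bar>W u \<omega> - W (real (k - 1) * h) \<omega>\<bar> \<le> \<eta> / 2"
      and prob_Bd: "prob Bd \<le>
        real n * (4 * (fact (2 * p) / (2 ^ p * fact p) * (sqrt h / (\<eta> / 2)) ^ (2 * p)))"
      using oscillation_event[OF \<eta>, of p] by metis
    have "prob Bd \<le> c * \<eta>"
    proof -
      have "sqrt h / (\<eta> / 2) = 2 * h powr \<delta>"
        using h by (simp add: \<eta>_def powr_half_sqrt[symmetric] powr_diff)
      then have "(sqrt h / (\<eta> / 2)) ^ (2 * p) = 2 ^ (2 * p) * h powr (\<delta> * real (2 * p))"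
        using h by (simp add: power_mult_distrib powr_powr flip: powr_realpow)
      then have "prob Bd \<le> 4 * (fact (2 * p) / (2 ^ p * fact p) * 2 ^ (2 * p)) *
          (real n * h powr (\<delta> * real (2 * p)))"
        using prob_Bd by (simp add: mult_ac)
      also have "real n * h powr (\<delta> * real (2 * p)) = T * h powr (\<delta> * real (2 * p) - 1)"
        unfolding h(3)[symmetric] using h(1) by (simp add: powr_diff)
      also have "4 * (fact (2 * p) / (2 ^ p * fact p) * 2 ^ (2 * p)) * (T * h powr (\<delta> * real (2 * p) - 1))
          \<le> 4 * (fact (2 * p) / (2 ^ p * fact p) * 2 ^ (2 * p)) *
          (T * (T powr (\<delta> * real (2 * p) - 1 - (1 / 2 - \<delta>)) * h powr (1 / 2 - \<delta>)))"
        using h T p \<delta> by (intro mult_left_mono powr_le_scaled) auto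
      finally show ?thesis by (simp add: c_def \<eta>_def mult_ac)
    qed
    have hit: "prob (first_hit_in k) \<le> K * (h * (real k * h) powr (- \<gamma>))" if "1 \<le> k" "k \<le> n" for k
    proof -
      have "real k * h \<le> real n * h" using that h by (intro mult_right_mono) auto
      then show ?thesis
        unfolding prob_first_hit_in[OF that(2)] using that h by (intro increment) auto
    qed
    have hit': "prob (first_hit_in k) \<le> K * T powr (1 - \<gamma> - (1 / 2 - \<delta>)) * \<eta>" if "k \<le> n" for k
    proof (cases "k = 0")
      case True
      then show ?thesis using K \<eta> by (simp add: first_hit_in_def)
    next
      case False
      then have "prob (first_hit_in k) \<le> K * (h * (real k * h) powr (- \<gamma>))"
        using that by (intro hit) auto
      also have "\<dots> \<le> K * (h * h powr (- \<gamma>))"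
        using K h False \<gamma> by (intro mult_left_mono powr_mono2') auto
      also have "h * h powr (- \<gamma>) = h powr (1 - \<gamma>)"
        using h by (simp add: powr_diff powr_minus_divide)
      also have "K * h powr (1 - \<gamma>) \<le> K * (T powr (1 - \<gamma> - (1 / 2 - \<delta>)) * h powr (1 / 2 - \<delta>))"
        using K h \<gamma> \<delta> by (intro mult_left_mono powr_le_scaled) auto
      finally show ?thesis by (simp add: \<eta>_def mult_ac)
    qed
    define w where "w i k = h * (real k * h) powr (- \<gamma>) * (real (i - k) * h) powr (- (1 / 2))" for i k
    have w: "0 \<le> w i k" for i k using h by (simp add: w_def)
    have err0: "0 \<le> err k" if "k \<le> n" for k
      using scheme_le_loss[OF that] by simp
    have kernel_bound: "prob (first_hit_in k) *
        ((2 * \<alpha> * err k + 4 * \<eta>) / (sqrt (real (i - 1 - k) * h) * sqrt (2 * pi))) \<le>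
        K * w i k * (2 * \<alpha> * err k + 4 * \<eta>)" if k: "k \<in> {1..<i - 1}" and i: "i \<le> n" for i k
    proof -
      have num: "0 \<le> 2 * \<alpha> * err k + 4 * \<eta>"
        using err0[of k] k i \<alpha>_pos \<eta> by (intro add_nonneg_nonneg mult_nonneg_nonneg) auto
      have y: "0 < real (i - k) * h" using k h by auto
      \<comment> \<open>the scheme is one step short, which costs at most a factor \<open>2\<close> under the root\<close>
      have "sqrt (real (i - k) * h) \<le> sqrt (real (i - 1 - k) * h) * sqrt (2 * pi)"
      proof -
        have "i - k \<le> (i - 1 - k) * 2" using k by auto
        then have "real (i - k) \<le> real ((i - 1 - k) * 2)" by (rule of_nat_mono)
        also have "\<dots> = real (i - 1 - k) * 2" by simp
        also have "\<dots> \<le> real (i - 1 - k) * (2 * pi)"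
          using pi_gt3 by (intro mult_left_mono) auto
        finally have "real (i - k) * h \<le> real (i - 1 - k) * (2 * pi) * h"
          using h by (intro mult_right_mono) auto
        then show ?thesis by (simp add: real_sqrt_mult[symmetric] mult_ac)
      qed
      then have "(2 * \<alpha> * err k + 4 * \<eta>) / (sqrt (real (i - 1 - k) * h) * sqrt (2 * pi)) \<le>
          (2 * \<alpha> * err k + 4 * \<eta>) / sqrt (real (i - k) * h)"
        using num y by (intro divide_left_mono mult_pos_pos) (use k h in auto)
      also have "\<dots> = (real (i - k) * h) powr (- (1 / 2)) * (2 * \<alpha> * err k + 4 * \<eta>)"
        using powr_half_sqrt[of "real (i - k) * h"] y by (simp only: powr_minus_divide) simp
      finally have "prob (first_hit_in k) *
          ((2 * \<alpha> * err k + 4 * \<eta>) / (sqrt (real (i - 1 - k) * h) * sqrt (2 * pi))) \<le>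
          (K * (h * (real k * h) powr (- \<gamma>))) *
          ((real (i - k) * h) powr (- (1 / 2)) * (2 * \<alpha> * err k + 4 * \<eta>))"
        using k i K h num by (intro mult_mono hit) auto
      then show ?thesis by (simp add: w_def mult_ac)
    qed
    have w_sum: "(\<Sum>k=1..<i. w i k) \<le> 2 * T powr \<kappa> / \<kappa>" if i: "i \<le> n" for i
    proof -
      have "(\<Sum>k=1..<i. w i k) \<le> 2 * (real i * h) powr \<kappa> / \<kappa>"
        unfolding w_def using \<kappa> \<gamma> h by (intro singular_kernel_sum_le) auto
      also have "\<dots> \<le> 2 * T powr \<kappa> / \<kappa>"
      proof -
        have "real i * h \<le> real n * h" using i h by (intro mult_right_mono) auto
        then show ?thesis
          using h \<kappa> by (intro divide_right_mono mult_left_mono powr_mono2) auto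
      qed
      finally show ?thesis .
    qed
    have "err i \<le> C * \<eta> + 2 * \<alpha> * K * (\<Sum>k=1..<i. w i k * err k)" if i: "i \<le> n" for i
    proof (cases "i = 0")
      case True
      then show ?thesis
        using scheme L_0 C0 \<eta> by (simp add: discrete_loss_def)
    next
      case False
      have "(\<Sum>k=1..<i - 1. prob (first_hit_in k) *
          ((2 * \<alpha> * err k + 4 * \<eta>) / (sqrt (real (i - 1 - k) * h) * sqrt (2 * pi)))) \<le>
          (\<Sum>k=1..<i - 1. K * w i k * (2 * \<alpha> * err k + 4 * \<eta>))"
        by (intro sum_mono kernel_bound i)
      also have "\<dots> \<le> (\<Sum>k=1..<i. K * w i k * (2 * \<alpha> * err k + 4 * \<eta>))"
      proof (rule sum_mono2)
        fix k assume "k \<in> {1..<i} - {1..<i - 1}"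
        then show "0 \<le> K * w i k * (2 * \<alpha> * err k + 4 * \<eta>)"
          using K w err0[of k] i \<alpha>_pos \<eta> by (intro mult_nonneg_nonneg add_nonneg_nonneg) auto
      qed auto
      also have "\<dots> = 2 * \<alpha> * K * (\<Sum>k=1..<i. w i k * err k) + 4 * K * \<eta> * (\<Sum>k=1..<i. w i k)"
        by (simp add: sum_distrib_left sum.distrib[symmetric] algebra_simps)
      also have "4 * K * \<eta> * (\<Sum>k=1..<i. w i k) \<le> 4 * K * \<eta> * (2 * T powr \<kappa> / \<kappa>)"
        using K \<eta> by (intro mult_left_mono w_sum i) auto
      finally have "(\<Sum>k=1..<i - 1. prob (first_hit_in k) *
          ((2 * \<alpha> * err k + 4 * \<eta>) / (sqrt (real (i - 1 - k) * h) * sqrt (2 * pi)))) \<le>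
          2 * \<alpha> * K * (\<Sum>k=1..<i. w i k * err k) + 4 * K * \<eta> * (2 * T powr \<kappa> / \<kappa>)"
        by simp
      moreover have "err i \<le> 2 * prob Bd + prob (first_hit_in i) + prob (first_hit_in (i - 1)) +
          (\<Sum>k=1..<i - 1. prob (first_hit_in k) *
            ((2 * \<alpha> * err k + 4 * \<eta>) / (sqrt (real (i - 1 - k) * h) * sqrt (2 * pi))))"
        using False by (intro error_recursion[OF _ i \<eta> Bd osc]) auto
      moreover have "prob (first_hit_in (i - 1)) \<le> K * T powr (1 - \<gamma> - (1 / 2 - \<delta>)) * \<eta>"
        using i by (intro hit') auto
      moreover have "C * \<eta> = 2 * (c * \<eta>) + 2 * (K * T powr (1 - \<gamma> - (1 / 2 - \<delta>)) * \<eta>)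
          + 4 * K * \<eta> * (2 * T powr \<kappa> / \<kappa>)"
        by (simp add: C_def algebra_simps)
      ultimately show ?thesis
        using hit'[OF i] \<open>prob Bd \<le> c * \<eta>\<close> by linarith
    qed
    then have "err i \<le> G * (C * \<eta>)"
      using C0 \<eta> by (intro gronwall[OF n _ _ i]) (auto simp: w_def h_def)
    then have "err i \<le> (G * C + 1) * \<eta>"
      using \<eta> by (simp add: algebra_simps)
    moreover have "\<bar>Lt i - L (real i * h)\<bar> = err i"
      using err0[OF i] by simp
    ultimately show "\<bar>Lt i - L (real i * (T / real n))\<bar> \<le> (G * C + 1) * (T / real n) powr (1 / 2 - \<delta>)"
      by (simp add: h_def \<eta>_def)
  qed
qed

end

theorem theorem4:
  fixes M :: "'a measure" and F :: "real \<Rightarrow> 'a measure"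
    and W :: "real \<Rightarrow> 'a \<Rightarrow> real" and Y0 :: "'a \<Rightarrow> real"
    and f :: "real \<Rightarrow> real" and L L' :: "real \<Rightarrow> real"
    and \<alpha> \<beta> B Btilde Bhat Tstar T :: real
  assumes "filtered_prob_space M F"
    and "brownian_motion M F W"
    and "\<forall>\<omega>\<in>space M. 0 \<le> Y0 \<omega>"
    and "prob_space.indep_set M
           (sets (vimage_algebra (space M) Y0 borel))
           (sets (vimage_algebra (space M) (\<lambda>\<omega>. \<lambda>t\<in>{0..}. W t \<omega>) (PiM {0..} (\<lambda>_. borel))))"
    and "0 < \<alpha>" and "0 < \<beta>" and "\<beta> \<le> 1"
    and "\<forall>x. 0 \<le> f x" and "\<forall>x<0. f x = 0"
    and "distributed M lborel Y0 (\<lambda>x. ennreal (f x))"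
    and "smallest_const (\<lambda>c. \<forall>x\<ge>0. f x \<le> c * x powr \<beta>) B"
    and "mv_solution_up_to_explosion M \<alpha> Y0 W L"
    and "\<forall>t>0. ereal t < explosion_time L \<longrightarrow> H1_weak_deriv 0 t L L'"
    and "AE t in lborel. 0 < t \<longrightarrow> ereal t < explosion_time L \<longrightarrow>
           L' t \<le> Bhat * t powr (- ((1 - \<beta>) / 2))"
    and "smallest_const (\<lambda>c. \<forall>t\<ge>0. ereal t < explosion_time L \<longrightarrow>
           L t \<le> c * t powr ((1 + \<beta>) / 2)) Btilde"
    and "0 < Tstar"
    and "\<alpha> * B * (sqrt (2 * Tstar / pi)
           + \<alpha> * Btilde * Tstar powr ((1 + \<beta>) / 2)) powr \<beta> = 1"
    and "2 * \<alpha> * (Bhat * Tstar powr (- ((1 - \<beta>) / 2)) + 1 / sqrt Tstar) < 1"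
    and "0 < T" and "ereal T < explosion_time L"
  shows "\<forall>\<delta>>0. \<exists>C>0. \<forall>n\<ge>1. \<forall>Lt. discrete_loss M \<alpha> Y0 W (T / real n) n Lt \<longrightarrow>
           (MAX i\<in>{..n}. \<bar>Lt i - L (real i * (T / real n))\<bar>) \<le> C * (T / real n) powr (1 / 2 - \<delta>)"
proof -
  have "prob_space M"
    using assms(1) by (simp add: filtered_prob_space_def)
  from prob_space.brownian_motion_initial_enlargement[OF this assms(1,2,4)]
  obtain F' where F': "filtered_prob_space M F'" "brownian_motion M F' W"
    "\<And>t. 0 \<le> t \<Longrightarrow> Y0 \<in> borel_measurable (F' t)" by blast
  let ?S = "explosion_time L"
  have sol: "differentiable_mv_solution M \<alpha> Y0 W ?S L"
    using assms(12) by (simp add: mv_solution_up_to_explosion_def)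
  have "0 < ?S"
    using assms(19,20) by (auto intro: less_trans[of 0 "ereal T"])
  then interpret mv_system M F' W Y0 \<alpha> ?S L
    using F' \<open>prob_space M\<close> sol assms(5)
    by (auto simp: mv_system_def mv_system_axioms_def brownian_def brownian_axioms_def
        differentiable_mv_solution_def)
  define \<gamma> where "\<gamma> = (1 - \<beta>) / 2"
  have \<gamma>: "0 \<le> \<gamma>" "\<gamma> < 1 / 2" "1 - \<gamma> = (1 + \<beta>) / 2"
    using assms(6,7) by (auto simp: \<gamma>_def field_simps)
  have Lbound: "L t \<le> Btilde * t powr (1 - \<gamma>)" if "0 \<le> t" "ereal t < ?S" for t
    using assms(15) that unfolding smallest_const_def \<gamma>(3) by blast
  have increment: "L (real k * h) - L (real (k - 1) * h) \<le>
      (\<bar>Btilde\<bar> + 2 * \<bar>Bhat\<bar>) * (h * (real k * h) powr (- \<gamma>))"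
    if "0 < h" "1 \<le> k" "real k * h \<le> T" for h k
  proof (rule loss_increment_on_mesh[OF _ _ Lbound])
    show "H1_weak_deriv 0 t L L'" if "0 < t" "ereal t < ?S" for t
      using assms(13) that by blast
    show "AE t in lborel. 0 < t \<longrightarrow> ereal t < ?S \<longrightarrow> L' t \<le> Bhat * t powr (- \<gamma>)"
      using assms(14) by (simp add: \<gamma>_def)
    show "ereal (real k * h) < ?S"
      using that(3) assms(20) by (intro le_less_trans[of "ereal (real k * h)" "ereal T"]) auto
  qed (use that \<gamma> in auto)
  show ?thesis
  proof (intro allI impI)
    fix \<delta> :: real assume "0 < \<delta>"
    from scheme_error_rate[OF increment _ \<gamma>(1,2) assms(19,20) this]
    obtain C where "0 < C" and C: "\<And>n Lt i. 1 \<le> n \<Longrightarrow> discrete_loss M \<alpha> Y0 W (T / real n) n Lt \<Longrightarrow>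
        i \<le> n \<Longrightarrow> \<bar>Lt i - L (real i * (T / real n))\<bar> \<le> C * (T / real n) powr (1 / 2 - \<delta>)"
      by auto
    then show "\<exists>C>0. \<forall>n\<ge>1. \<forall>Lt. discrete_loss M \<alpha> Y0 W (T / real n) n Lt \<longrightarrow>
        (MAX i\<in>{..n}. \<bar>Lt i - L (real i * (T / real n))\<bar>) \<le> C * (T / real n) powr (1 / 2 - \<delta>)"
      by (intro exI[of _ C]) (auto simp: Max_le_iff)
  qed
qed

end
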